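(* Let $A=\begin{pmatrix}B & C^*\\ C & D\end{pmatrix}$ be a positive semidefinite block matrix with square diagonal blocks $B$ and $D$, and for $q>0$ let $\beta=\|B\|_q$, $\delta=\|D\|_q$, $\gamma=\|C\|_q$. Then for $1\le q\le2$, $$\operatorname{tr}A^q\le(2^q-2)\gamma^q+\beta^q+\delta^q,$$ and for $0<q\le1$ and for $2\le q\le3$ the reversed inequality $\operatorname{tr}A^q\ge(2^q-2)\gamma^q+\beta^q+\delta^q$ holds.
   Context: For a matrix $X$ and $q>0$, the Schatten $q$-(quasi)norm is $\|X\|_q=(\operatorname{tr}|X|^q)^{1/q}$, where $|X|=(X^*X)^{1/2}$. *)

theory Defs
  imports "Jordan_Normal_Form.Schur_Decomposition" "Jordan_Normal_Form.Spectral_Radius"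
begin

definition psd_mat :: "complex mat \<Rightarrow> nat \<Rightarrow> bool" where
  "psd_mat A n \<longleftrightarrow> A \<in> carrier_mat n n \<and> mat_adjoint A = A \<and>
     (\<forall>v \<in> carrier_vec n. 0 \<le> Re (\<Sum>i<n. cnj (v $ i) * (A *\<^sub>v v) $ i))"

(* tr A^p for a positive semidefinite (hence unitarily diagonalisable) matrix A:
   the sum of lambda^p over the eigenvalues lambda of A counted with algebraic multiplicity. *)
definition tr_pow :: "complex mat \<Rightarrow> real \<Rightarrow> real" where
  "tr_pow A p = (\<Sum>z \<in> {z. poly (char_poly A) z = 0}.
       real (order z (char_poly A)) * (Re z) powr p)"

(* Schatten q-(quasi)norm ||X||_q = (tr |X|^q)^(1/q), |X| = (X^* X)^(1/2),
   so tr |X|^q = tr (X^* X)^(q/2). *)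
definition schatten :: "complex mat \<Rightarrow> real \<Rightarrow> real" where
  "schatten X q = (tr_pow (mat_adjoint X * X) (q / 2)) powr (1 / q)"

end

theory Submission
  imports Defs "HOL-Analysis.Analysis" "HOL-Real_Asymp.Real_Asymp"
begin

hide_const (open) Determinants.det Finite_Cartesian_Product.mat

text \<open>
  Write the block matrix as $X^* X$ with $X = (X_1\ X_2)$ and put $P = X_1 X_1^*$, $Q = X_2 X_2^*$.
  Then $A$, $B$, $D$ and $C^* C$ have, up to zeros, the eigenvalues $s_k$ of $P + Q$, $p_i$ of $P$,
  $r_j$ of $Q$ and $\mu_k$ of $P^{1/2} Q P^{1/2}$.  Let $w_{ij} = |\langle x_i, y_j \rangle|^2$ be the
  overlaps of the eigenvectors of $P$ and $Q$; they form a doubly stochastic matrix.  A variational argument gives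
  $\sum_k 1/(s_k+t) \le \sum_{ij} w_{ij}/(p_i+r_j+t)$, and since the moments of order 0, 1 and 2 of the
  two sides agree, integration over $t$ compares $\mathrm{tr}\,(P+Q)^q$ with $\sum_{ij} w_{ij} (p_i+r_j)^q$,
  the direction changing at $q = 1$ and $q = 2$.  A scalar inequality bounds $(p+r)^q$ by
  $p^q + r^q + (2^q-2)(pr)^{q/2}$.  Finally $\sum_{ij} w_{ij} (p_i r_j)^{q/2}$ is compared with
  $\sum_k \mu_k^{q/2}$: the resolvent inequality for $P^{-1}$ and $tQ$ integrates to
  $\log\det(1 + tPQ) \ge \sum_{ij} w_{ij} \log(1 + t p_i r_j)$, and powers are integrals of such logarithms.
\<close>

section \<open>Signs of power sums from kernels\<close>

text \<open>The obstacle is that P and Q need not commute. If they did, a common eigenbasis would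
  give s_k = p_k + r_k and mu_k = p_k r_k, and the scalar inequality would settle everything. In
  general the weights w_ij spread the scalar inequality over all pairs, at the price of two
  comparisons, one for sums and one for products, and all three inequalities must point the same
  way. They do: the comparison of s_k with p_i + r_j and the scalar inequality both change direction
  at q = 1 and q = 2, while the comparison of (p_i r_j)^(q/2) with mu_k^(q/2) changes only at q = 2
  but enters with the factor 2^q - 2, which changes sign at q = 1. This factor is forced by p = r,
  where the scalar inequality is an equality.\<close>

lemma powr_kernel_integral:
  fixes g :: "real \<Rightarrow> real"
  assumes [measurable]: "g \<in> borel_measurable borel"
    and pos: "\<And>u. 0 < u \<Longrightarrow> 0 < g u"
    and small: "\<And>u. 0 < u \<Longrightarrow> u \<le> 1 \<Longrightarrow> g u \<le> C * u powr \<alpha>"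
    and large: "\<And>u. 1 \<le> u \<Longrightarrow> g u \<le> C * u powr \<beta>"
    and "\<beta> < \<theta>" "\<theta> < \<alpha>"
  obtains K where "K > 0"
    "\<And>x. x > 0 \<Longrightarrow> has_bochner_integral lborel
       (\<lambda>t. indicator {0<..} t * (g (t * x) * t powr (- \<theta> - 1))) (K * x powr \<theta>)"
proof -
  \<comment> \<open>\<open>F\<close> is the integrand at x = 1. The bound with exponent \<alpha>
    makes it integrable near 0, the one with \<beta> near infinity.\<close>
  define F where "F = (\<lambda>u. indicator {0<..} u * (g u * u powr (- \<theta> - 1)))"
  have [measurable]: "F \<in> borel_measurable borel" unfolding F_def by measurable
  have F0: "0 \<le> F u" for u
    using pos[of u] by (auto simp: F_def indicator_def)
  have C: "C \<ge> 0" using pos[of 1] small[of 1] by simp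
  have int1: "integrable lborel (\<lambda>u. indicator {0..1} u * u powr (\<alpha> - \<theta> - 1))"
  proof (rule integrableI_nonneg)
    show "(\<integral>\<^sup>+ u. ennreal (indicator {0..1} u * u powr (\<alpha> - \<theta> - 1)) \<partial>lborel) < \<infinity>"
      using nn_integral_has_integral_lebesgue[OF _ has_integral_powr_from_0[of "\<alpha> - \<theta> - 1" 1]] assms
      by (simp add: nn_integral_completion)
  qed (auto simp: indicator_def)
  have int2: "integrable lborel (\<lambda>u. indicator {1..} u * u powr (\<beta> - \<theta> - 1))"
  proof (rule integrableI_nonneg)
    show "(\<integral>\<^sup>+ u. ennreal (indicator {1..} u * u powr (\<beta> - \<theta> - 1)) \<partial>lborel) < \<infinity>"
      using nn_integral_has_integral_lebesgue[OF _ has_integral_powr_to_inf[of "\<beta> - \<theta> - 1" 1]] assms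
      by (simp add: nn_integral_completion)
  qed (auto simp: indicator_def)
  have intF: "integrable lborel F"
  proof (rule Bochner_Integration.integrable_bound)
    show "integrable lborel (\<lambda>u. C * (indicator {0..1} u * u powr (\<alpha> - \<theta> - 1))
        + C * (indicator {1..} u * u powr (\<beta> - \<theta> - 1)))"
      using int1 int2 by auto
    show "AE u in lborel. norm (F u) \<le> norm (C * (indicator {0..1} u * u powr (\<alpha> - \<theta> - 1))
        + C * (indicator {1..} u * u powr (\<beta> - \<theta> - 1)))"
    proof (rule AE_I2)
      fix u :: real
      let ?r = "C * (indicator {0..1} u * u powr (\<alpha> - \<theta> - 1))
        + C * (indicator {1..} u * u powr (\<beta> - \<theta> - 1))"
      have "F u \<le> ?r"
      proof (cases "0 < u")
        case u: True
        have e: "g u * u powr (- \<theta> - 1) \<le> C * u powr (a - \<theta> - 1)" if "g u \<le> C * u powr a" for a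
        proof -
          have eq: "a + (- \<theta> - 1) = a - \<theta> - 1" by simp
          have "g u * u powr (- \<theta> - 1) \<le> (C * u powr a) * u powr (- \<theta> - 1)"
            by (rule mult_right_mono[OF that]) simp
          also have "\<dots> = C * u powr (a - \<theta> - 1)"
            using powr_add[of u a "- \<theta> - 1"] unfolding eq by simp
          finally show ?thesis .
        qed
        have nn: "0 \<le> C * u powr a" for a using C by simp
        show ?thesis
          using e[OF small[OF u]] e[OF large] nn u
          by (cases "u < 1"; cases "u = 1") (auto simp: F_def)
      qed (use C in \<open>auto simp: F_def indicator_def\<close>)
      moreover have "0 \<le> ?r" using C by (auto simp: indicator_def)
      ultimately show "norm (F u) \<le> norm ?r" using F0[of u] by simp
    qed
  qed simp
  define K where "K = integral\<^sup>L lborel F"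
  \<comment> \<open>A vanishing integral would make \<open>F\<close> zero almost everywhere,
    although it is positive on the interval (0,1].\<close>
  have "K \<noteq> 0"
  proof
    assume "K = 0"
    then have "AE u in lborel. F u = 0"
      using integral_nonneg_eq_0_iff_AE[OF intF] F0 by (simp add: K_def)
    then have "AE u in lborel. u \<notin> {0<..(1::real)}"
    proof (rule AE_mp, intro AE_I2 impI notI)
      fix u :: real assume "F u = 0" "u \<in> {0<..1}"
      then show False using pos[of u] by (auto simp: F_def)
    qed
    then have "emeasure lborel {0<..(1::real)} = 0"
      by (subst (asm) AE_iff_measurable[OF _ refl]) (auto simp: greaterThanAtMost_def greaterThan_def atMost_def Int_def)
    then show False by simp
  qed
  moreover have "K \<ge> 0" unfolding K_def by (rule integral_nonneg_AE) (use F0 in auto)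
  moreover have "has_bochner_integral lborel
       (\<lambda>t. indicator {0<..} t * (g (t * x) * t powr (- \<theta> - 1))) (K * x powr \<theta>)" if x: "x > 0" for x
  proof -
    \<comment> \<open>Substitution u = x t: the factor x^(\<theta>+1) restores t^(-\<theta>-1), and
      the Jacobian 1/x then leaves x^\<theta>.\<close>
    have eq: "F (0 + x * t) * x powr (\<theta> + 1) = indicator {0<..} t * (g (t * x) * t powr (- \<theta> - 1))" for t
    proof (cases "t > 0")
      case True
      have "(x * t) powr (- \<theta> - 1) * x powr (\<theta> + 1) = t powr (- \<theta> - 1)"
        using x True by (simp add: powr_mult powr_add[symmetric] mult.commute mult.left_commute)
      then show ?thesis using x True by (simp add: F_def mult.commute mult.left_commute)
    next
      case False
      then show ?thesis using x by (auto simp: F_def indicator_def zero_less_mult_iff)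
    qed
    have "has_bochner_integral lborel F K"
      unfolding K_def by (rule has_bochner_integral_integrable[OF intF])
    then have "has_bochner_integral lborel (\<lambda>t. F (0 + x * t)) (K /\<^sub>R \<bar>x\<bar>)"
      by (subst (asm) lborel_has_bochner_integral_real_affine_iff[of x _ _ 0]) (use x in auto)
    then have "has_bochner_integral lborel (\<lambda>t. F (0 + x * t) * x powr (\<theta> + 1)) (K /\<^sub>R \<bar>x\<bar> * x powr (\<theta> + 1))"
      by (rule has_bochner_integral_mult_left)
    moreover have "K /\<^sub>R \<bar>x\<bar> * x powr (\<theta> + 1) = K * x powr \<theta>"
      using x by (simp add: powr_add field_simps)
    ultimately show ?thesis unfolding eq by (simp only:)
  qed
  ultimately show thesis using that[of K] by force
qed

text \<open>Up to a positive constant, x^\<theta> is the integral of g(t x) against the positive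
  measure t^(-\<theta>-1) dt, so a sign valid at every scale t passes to the power sum. The
  condition \<open>g 0 = 0\<close> matches the convention \<open>0 powr \<theta> = 0\<close> and
  admits zero points.\<close>

lemma sum_powr_nonneg_of_kernel:
  fixes g :: "real \<Rightarrow> real"
  assumes "g \<in> borel_measurable borel" "g 0 = 0"
    and "\<And>u. 0 < u \<Longrightarrow> 0 < g u"
    and "\<And>u. 0 < u \<Longrightarrow> u \<le> 1 \<Longrightarrow> g u \<le> C * u powr \<alpha>"
    and "\<And>u. 1 \<le> u \<Longrightarrow> g u \<le> C * u powr \<beta>"
    and "\<beta> < \<theta>" "\<theta> < \<alpha>"
    and x: "\<And>a. a \<in> I \<Longrightarrow> 0 \<le> x a"
    and nn: "\<And>t. 0 < t \<Longrightarrow> 0 \<le> (\<Sum>a\<in>I. c a * g (t * x a))"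
  shows "0 \<le> (\<Sum>a\<in>I. c a * x a powr \<theta>)"
proof -
  obtain K where K: "K > 0" and
    int: "\<And>x. x > 0 \<Longrightarrow> has_bochner_integral lborel
       (\<lambda>t. indicator {0<..} t * (g (t * x) * t powr (- \<theta> - 1))) (K * x powr \<theta>)"
    using powr_kernel_integral[OF assms(1,3-7)] by blast
  have int': "has_bochner_integral lborel
       (\<lambda>t. indicator {0<..} t * (g (t * x a) * t powr (- \<theta> - 1))) (K * x a powr \<theta>)" if "a \<in> I" for a
    using int[of "x a"] x[OF that] \<open>g 0 = 0\<close> by (cases "x a = 0") (auto intro: has_bochner_integral_zero)
  have "has_bochner_integral lborel
       (\<lambda>t. \<Sum>a\<in>I. c a * (indicator {0<..} t * (g (t * x a) * t powr (- \<theta> - 1)))) (\<Sum>a\<in>I. c a * (K * x a powr \<theta>))"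
    by (intro has_bochner_integral_sum has_bochner_integral_mult_right int')
  moreover have "0 \<le> (\<Sum>a\<in>I. c a * (indicator {0<..} t * (g (t * x a) * t powr (- \<theta> - 1))))" for t
  proof (cases "t > 0")
    case True
    have "0 \<le> (\<Sum>a\<in>I. c a * g (t * x a)) * t powr (- \<theta> - 1)" using nn[OF True] by simp
    then show ?thesis using True by (simp add: sum_distrib_right mult.assoc)
  qed simp
  ultimately have "0 \<le> (\<Sum>a\<in>I. c a * (K * x a powr \<theta>))"
    by (metis (no_types, lifting) Bochner_Integration.integral_nonneg has_bochner_integral_integral_eq)
  also have "\<dots> = K * (\<Sum>a\<in>I. c a * x a powr \<theta>)"
    by (simp add: sum_distrib_left mult.left_commute)
  finally show ?thesis using K by (simp add: zero_le_mult_iff)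
qed

text \<open>For k < q < k+1 the kernel is u^(k+1)/(1+u). Dividing by 1+u gives a polynomial of
  degree k, killed by the vanishing moments, plus (-1)^(k+1)/(1+u); hence the alternating direction.
  At q = 1 and q = 2 the sum is itself a vanishing moment.\<close>

lemma sum_powr_sign_of_resolvent:
  fixes x c :: "'a \<Rightarrow> real"
  assumes x: "\<And>a. a \<in> I \<Longrightarrow> 0 \<le> x a"
    and m0: "(\<Sum>a\<in>I. c a) = 0" and m1: "(\<Sum>a\<in>I. c a * x a) = 0" and m2: "(\<Sum>a\<in>I. c a * (x a)\<^sup>2) = 0"
    and res: "\<And>t. 0 < t \<Longrightarrow> 0 \<le> (\<Sum>a\<in>I. c a / (1 + t * x a))"
  shows "1 \<le> q \<Longrightarrow> q \<le> 2 \<Longrightarrow> 0 \<le> (\<Sum>a\<in>I. c a * x a powr q)"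
    and "0 < q \<Longrightarrow> q \<le> 1 \<Longrightarrow> (\<Sum>a\<in>I. c a * x a powr q) \<le> 0"
    and "2 \<le> q \<Longrightarrow> q \<le> 3 \<Longrightarrow> (\<Sum>a\<in>I. c a * x a powr q) \<le> 0"
proof -
  \<comment> \<open>These are the growth conditions at 0 and at infinity with exponents k+1 and k,
    which leave the open interval k < \<theta> < k+1.\<close>
  have bnd: "u ^ Suc k / (1 + u) \<le> 1 * u powr Suc k" "u ^ Suc k / (1 + u) \<le> 1 * u powr k"
    if "u > 0" for u :: real and k :: nat
  proof -
    have "u ^ Suc k / (1 + u) \<le> u ^ Suc k" "u ^ Suc k / (1 + u) \<le> u ^ k"
      using that by (auto simp: field_simps)
    then show "u ^ Suc k / (1 + u) \<le> 1 * u powr Suc k" "u ^ Suc k / (1 + u) \<le> 1 * u powr k"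
      using that by (simp_all only: powr_realpow mult_1)
  qed
  have ker: "0 \<le> (\<Sum>a\<in>I. d a * x a powr \<theta>)"
    if "real k < \<theta>" "\<theta> < Suc k" "\<And>t. 0 < t \<Longrightarrow> 0 \<le> (\<Sum>a\<in>I. d a * ((t * x a) ^ Suc k / (1 + t * x a)))"
    for k \<theta> d
    using bnd that x
    by (intro sum_powr_nonneg_of_kernel[where g = "\<lambda>u. u ^ Suc k / (1 + u)" and \<alpha> = "Suc k" and \<beta> = k and C = 1])
       (auto simp del: power_Suc mult_1 of_nat_Suc intro!: divide_pos_pos)
  have dn: "1 + t * x a \<noteq> 0" if "t > 0" "a \<in> I" for t a
    using x[OF that(2)] that(1) by (smt (verit) mult_nonneg_nonneg)
  have k1: "(\<Sum>a\<in>I. c a * ((t * x a) ^ Suc 0 / (1 + t * x a))) = - (\<Sum>a\<in>I. c a / (1 + t * x a))" if t: "t > 0" for t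
  proof -
    have "(\<Sum>a\<in>I. c a * ((t * x a) ^ Suc 0 / (1 + t * x a))) = (\<Sum>a\<in>I. c a - c a / (1 + t * x a))"
      by (rule sum.cong[OF refl]) (use dn[OF t] in \<open>simp add: field_simps\<close>)
    then show ?thesis by (simp add: sum_subtractf m0)
  qed
  have k2: "(\<Sum>a\<in>I. c a * ((t * x a) ^ Suc 1 / (1 + t * x a))) = (\<Sum>a\<in>I. c a / (1 + t * x a))" if t: "t > 0" for t
  proof -
    have "(\<Sum>a\<in>I. c a * ((t * x a) ^ Suc 1 / (1 + t * x a))) = (\<Sum>a\<in>I. t * (c a * x a) - c a + c a / (1 + t * x a))"
      by (rule sum.cong[OF refl]) (use dn[OF t] in \<open>simp add: field_simps power2_eq_square\<close>)
    then show ?thesis by (simp add: sum_subtractf sum.distrib m0 m1 sum_distrib_left[symmetric])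
  qed
  have k3: "(\<Sum>a\<in>I. c a * ((t * x a) ^ Suc 2 / (1 + t * x a))) = - (\<Sum>a\<in>I. c a / (1 + t * x a))" if t: "t > 0" for t
  proof -
    have "(\<Sum>a\<in>I. c a * ((t * x a) ^ Suc 2 / (1 + t * x a)))
        = (\<Sum>a\<in>I. t\<^sup>2 * (c a * (x a)\<^sup>2) - t * (c a * x a) + c a - c a / (1 + t * x a))"
      by (rule sum.cong[OF refl]) (use dn[OF t] in \<open>simp add: field_simps power2_eq_square power3_eq_cube\<close>)
    then show ?thesis by (simp add: sum_subtractf sum.distrib m0 m1 m2 sum_distrib_left[symmetric])
  qed
  have p1: "(\<Sum>a\<in>I. c a * x a powr 1) = 0" using m1 x by (simp cong: sum.cong)
  have p2: "(\<Sum>a\<in>I. c a * x a powr 2) = 0" using m2 x by (simp cong: sum.cong)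
  show "0 \<le> (\<Sum>a\<in>I. c a * x a powr q)" if "1 \<le> q" "q \<le> 2"
    using ker[of 1 q c] k2 res p1 p2 that by (cases "q = 1"; cases "q = 2") auto
  show "(\<Sum>a\<in>I. c a * x a powr q) \<le> 0" if "0 < q" "q \<le> 1"
    using ker[of 0 q "\<lambda>a. - c a"] k1 res p1 that by (cases "q = 1") (auto simp: sum_negf)
  have lt3: "(\<Sum>a\<in>I. c a * x a powr q) \<le> 0" if "2 \<le> q" "q < 3" for q
    using ker[of 2 q "\<lambda>a. - c a"] k3 res p2 that by (cases "q = 2") (auto simp: sum_negf)
  \<comment> \<open>No third moment is assumed to vanish, so the endpoint 3 is reached as a left
    limit.\<close>
  have "(\<Sum>a\<in>I. c a * x a powr 3) \<le> 0"
  proof (rule tendsto_upperbound)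
    show "((\<lambda>q. \<Sum>a\<in>I. c a * x a powr q) \<longlongrightarrow> (\<Sum>a\<in>I. c a * x a powr 3)) (at_left 3)"
    proof (intro tendsto_sum tendsto_mult tendsto_const)
      fix a assume "a \<in> I"
      show "((\<lambda>q. x a powr q) \<longlongrightarrow> x a powr 3) (at_left 3)"
        by (cases "x a = 0") (auto intro!: tendsto_powr tendsto_ident_at)
    qed
    show "\<forall>\<^sub>F q in at_left 3. (\<Sum>a\<in>I. c a * x a powr q) \<le> 0"
      using eventually_at_left_real[of 2 3] lt3 by (auto elim!: eventually_mono)
  qed simp
  then show "(\<Sum>a\<in>I. c a * x a powr q) \<le> 0" if "2 \<le> q" "q \<le> 3"
    using lt3[of q] that by (cases "q = 3") auto
qed

text \<open>The kernel is ln(1+u) for s < 1 and u - ln(1+u) for s > 1. In the second the first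
  moment removes the linear term and leaves minus the logarithmic sum, which flips the sign.\<close>

lemma sum_powr_sign_of_log:
  fixes x c :: "'a \<Rightarrow> real"
  assumes x: "\<And>a. a \<in> I \<Longrightarrow> 0 \<le> x a"
    and m1: "(\<Sum>a\<in>I. c a * x a) = 0"
    and log: "\<And>t. 0 < t \<Longrightarrow> 0 \<le> (\<Sum>a\<in>I. c a * ln (1 + t * x a))"
  shows "0 < s \<Longrightarrow> s \<le> 1 \<Longrightarrow> 0 \<le> (\<Sum>a\<in>I. c a * x a powr s)"
    and "1 \<le> s \<Longrightarrow> s < 2 \<Longrightarrow> (\<Sum>a\<in>I. c a * x a powr s) \<le> 0"
proof -
  have p1: "(\<Sum>a\<in>I. c a * x a powr 1) = 0" using m1 x by (simp cong: sum.cong)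
  show "0 \<le> (\<Sum>a\<in>I. c a * x a powr s)" if s: "0 < s" "s \<le> 1"
  proof (cases "s = 1")
    case False
    \<comment> \<open>The exponent s/2 is merely some positive number below s. The second summand
      comes from \<open>ln_powr_bound\<close> with 1 + u \<le> 2u; the first secures ln(1+u) \<le> C
      u near 0.\<close>
    define C where "C = 1 + 2 powr (s/2) / (s/2)"
    show ?thesis
    proof (rule sum_powr_nonneg_of_kernel[where g = "\<lambda>u. ln (1 + u)" and \<alpha> = 1 and \<beta> = "s/2" and C = C])
      show "ln (1 + u) \<le> C * u powr 1" if u: "0 < u" "u \<le> 1" for u :: real
      proof -
        have "ln (1 + u) \<le> 1 * u" using u ln_add_one_self_le_self[of u] by simp
        also have "\<dots> \<le> C * u" using u s by (intro mult_right_mono) (auto simp: C_def)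
        finally show ?thesis using u by simp
      qed
      show "ln (1 + u) \<le> C * u powr (s/2)" if u: "1 \<le> u" for u :: real
      proof -
        have "ln (1 + u) \<le> (1 + u) powr (s/2) / (s/2)"
          using u s ln_powr_bound[of "1 + u" "s/2"] by simp
        also have "\<dots> \<le> (2 * u) powr (s/2) / (s/2)"
          using u s by (intro divide_right_mono powr_mono2) auto
        also have "\<dots> = (2 powr (s/2) / (s/2)) * u powr (s/2)" using u by (simp add: powr_mult)
        also have "\<dots> \<le> C * u powr (s/2)" by (intro mult_right_mono) (auto simp: C_def)
        finally show ?thesis .
      qed
    qed (use s False x log in auto)
  qed (use p1 in simp)
  show "(\<Sum>a\<in>I. c a * x a powr s) \<le> 0" if s: "1 \<le> s" "s < 2"
  proof (cases "s = 1")
    case False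
    have "0 \<le> (\<Sum>a\<in>I. - c a * x a powr s)"
    proof (rule sum_powr_nonneg_of_kernel[where g = "\<lambda>u. u - ln (1 + u)" and \<alpha> = 2 and \<beta> = 1 and C = 1])
      show "0 < u - ln (1 + u)" if "0 < u" for u :: real
        using that ln_add_one_self_le_self[of u] ln_eq_minus_one[of "1 + u"] ln_le_minus_one[of "1 + u"]
        by (smt (verit))
      show "u - ln (1 + u) \<le> 1 * u powr 2" if "0 < u" "u \<le> 1" for u :: real
        using ln_one_plus_pos_lower_bound[of u] that by simp
      show "u - ln (1 + u) \<le> 1 * u powr 1" if "1 \<le> u" for u :: real
        using that by simp
      show "0 \<le> (\<Sum>a\<in>I. - c a * (t * x a - ln (1 + t * x a)))" if "0 < t" for t
      proof -
        have "(\<Sum>a\<in>I. - c a * (t * x a - ln (1 + t * x a)))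
            = - (t * (\<Sum>a\<in>I. c a * x a)) + (\<Sum>a\<in>I. c a * ln (1 + t * x a))"
          by (simp add: sum_distrib_left sum_subtractf[symmetric] algebra_simps)
        then show ?thesis using log[OF that] m1 by simp
      qed
    qed (use s False x in auto)
    then show ?thesis by (simp add: sum_negf)
  qed (use p1 in simp)
qed

text \<open>The function \<open>H\<close> of the shift t has the resolvent sum as its derivative, so
  it increases, and it tends to 0 at infinity because the total mass is 0. Hence its value at 0 is
  at most 0.\<close>

lemma sum_ln_nonpos_of_resolvent:
  fixes x c :: "'a \<Rightarrow> real"
  assumes x: "\<And>a. a \<in> I \<Longrightarrow> 0 < x a" and m0: "(\<Sum>a\<in>I. c a) = 0"
    and res: "\<And>t. 0 \<le> t \<Longrightarrow> 0 \<le> (\<Sum>a\<in>I. c a / (x a + t))"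
  shows "(\<Sum>a\<in>I. c a * ln (x a)) \<le> 0"
proof -
  define H where "H = (\<lambda>t. \<Sum>a\<in>I. c a * ln (x a + t))"
  have mono: "H 0 \<le> H t" if "0 \<le> t" for t
  proof (rule DERIV_nonneg_imp_nondecreasing[OF that])
    fix u :: real assume u: "0 \<le> u" "u \<le> t"
    have "(H has_real_derivative (\<Sum>a\<in>I. c a / (x a + u))) (at u)"
      unfolding H_def
    proof (rule DERIV_sum)
      fix a assume "a \<in> I"
      then have "x a + u > 0" using x[of a] u by simp
      then show "((\<lambda>t. c a * ln (x a + t)) has_real_derivative c a / (x a + u)) (at u)"
        by (auto intro!: derivative_eq_intros)
    qed
    then show "\<exists>y. (H has_real_derivative y) (at u) \<and> 0 \<le> y" using res[OF u(1)] by blast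
  qed
  \<comment> \<open>Subtracting ln t from every logarithm does not change \<open>H\<close>, since
    the masses sum to 0, and makes each term vanish in the limit.\<close>
  have "((\<lambda>t. \<Sum>a\<in>I. c a * (ln (x a + t) - ln t)) \<longlongrightarrow> (\<Sum>a\<in>I. c a * 0)) at_top"
  proof (intro tendsto_sum tendsto_mult tendsto_const)
    fix a
    show "((\<lambda>t. ln (x a + t) - ln t) \<longlongrightarrow> 0) at_top" by real_asymp
  qed
  moreover have "(\<Sum>a\<in>I. c a * (ln (x a + t) - ln t)) = H t" for t
    by (simp add: H_def algebra_simps sum_subtractf sum_distrib_left[symmetric] m0)
  ultimately have "(H \<longlongrightarrow> 0) at_top" by simp
  then have "H 0 \<le> 0"
    by (rule tendsto_lowerbound) (use mono in \<open>auto intro: eventually_mono[OF eventually_ge_at_top[of 0]]\<close>)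
  then show ?thesis by (simp add: H_def)
qed

text \<open>With g = sqrt(pr), the mixed term (2^q - 2)(pr)^(q/2) equals (2g)^q - 2 g^q. This turns
  the claim into a statement about five points whose masses have vanishing moments of order 0, 1 and
  2, the last because g^2 = pr; the same resolvent criterion as for the matrix sum then
  applies.\<close>

lemma powr_add_sign:
  fixes p r :: real
  assumes p: "0 \<le> p" and r: "0 \<le> r"
  shows "1 \<le> q \<Longrightarrow> q \<le> 2 \<Longrightarrow> (p + r) powr q \<le> (2 powr q - 2) * (p * r) powr (q/2) + p powr q + r powr q"
    and "0 < q \<Longrightarrow> q \<le> 1 \<Longrightarrow> (p + r) powr q \<ge> (2 powr q - 2) * (p * r) powr (q/2) + p powr q + r powr q"
    and "2 \<le> q \<Longrightarrow> q \<le> 3 \<Longrightarrow> (p + r) powr q \<ge> (2 powr q - 2) * (p * r) powr (q/2) + p powr q + r powr q"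
proof -
  define g where "g = sqrt (p * r)"
  have g: "0 \<le> g" "g\<^sup>2 = p * r" using p r by (simp_all add: g_def)
  have gp: "g powr q = (p * r) powr (q/2)" for q
    using p r by (simp add: g_def powr_half_sqrt[symmetric] powr_powr)
  have am: "2 * g \<le> p + r" using arith_geo_mean_sqrt[OF p r] by (simp add: g_def)
  \<comment> \<open>the discrete signed measure whose $q$-th moment is the difference of the two sides\<close>
  define x where "x = (!) [p + r, p, r, 2 * g, g]"
  define c where "c = (!) [-1, 1, 1, 1, -2 :: real]"
  have sum5: "(\<Sum>a<5. f a) = f 0 + f 1 + f 2 + f 3 + f 4" for f :: "nat \<Rightarrow> real"
    by (simp add: eval_nat_numeral)
  have [simp]: "x 0 = p + r" "x (Suc 0) = p" "x 2 = r" "x 3 = 2 * g" "x 4 = g"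
    "c 0 = -1" "c (Suc 0) = 1" "c 2 = 1" "c 3 = 1" "c 4 = -2"
    by (simp_all add: x_def c_def)
  have res: "0 \<le> (\<Sum>a<5. c a / (1 + t * x a))" if t: "0 < t" for t
  proof -
    define b where "b = t * g"
    \<comment> \<open>Put phi(z) = (1+z)/(z+b^2) - 1/z. The terms with p and r contribute phi(y),
      and those with g contribute -phi(y0), the case p = r = g. The arithmetic-geometric mean
      inequality gives y0 \<le> y, and in phi(y) - phi(y0) the factor y - y0 splits off with a
      nonnegative cofactor.\<close>
    define y where "y = 1 + t * (p + r)"
    define y0 where "y0 = 1 + 2 * b"
    have b: "0 \<le> b" using t g by (simp add: b_def)
    have y: "y0 \<le> y" "1 \<le> y0"
      using mult_left_mono[OF am, of t] t b by (simp_all add: y_def y0_def b_def)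
    have pos: "0 < 1 + t * p" "0 < 1 + t * r" "0 < y" "0 < y0" "0 < 1 + b" "0 < y + b\<^sup>2" "0 < y0 + b\<^sup>2"
      using t p r b y by (auto intro!: add_pos_nonneg)
    have pr: "(1 + t * p) * (1 + t * r) = y + b\<^sup>2"
      by (simp add: y_def b_def g(2) power_mult_distrib) (simp add: algebra_simps power2_eq_square)
    have "1 / (1 + t * p) + 1 / (1 + t * r) = (1 + y) / ((1 + t * p) * (1 + t * r))"
      using pos by (simp add: field_simps y_def)
    then have e1: "1 / (1 + t * p) + 1 / (1 + t * r) = (1 + y) / (y + b\<^sup>2)" by (simp only: pr)
    have "y0 + b\<^sup>2 = (1 + b)\<^sup>2" by (simp add: y0_def power2_eq_square algebra_simps)
    then have e2: "2 / (1 + b) = (1 + y0) / (y0 + b\<^sup>2)"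
      using pos by (simp add: y0_def power2_eq_square field_simps)
    have "(1 + y) / (y + b\<^sup>2) - 1 / y - ((1 + y0) / (y0 + b\<^sup>2) - 1 / y0)
       = b\<^sup>2 * (y - y0) * (y * y0 + y + y0 + b\<^sup>2) / (y * (y + b\<^sup>2) * (y0 * (y0 + b\<^sup>2)))"
    proof -
      have "(1 + z) / (z + b\<^sup>2) - 1 / z = (z\<^sup>2 - b\<^sup>2) / (z * (z + b\<^sup>2))" if "0 < z" "0 < z + b\<^sup>2" for z
        using that by (simp add: diff_frac_eq) (simp add: power2_eq_square algebra_simps)
      note this[OF pos(3,6)] this[OF pos(4,7)]
      then show ?thesis using pos
        by (simp add: diff_frac_eq) (simp add: power2_eq_square algebra_simps)
    qed
    also have "\<dots> \<ge> 0" using pos y by (intro divide_nonneg_pos mult_nonneg_nonneg) auto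
    finally have "0 \<le> (1 / (1 + t * p) + 1 / (1 + t * r)) - 1 / y - (2 / (1 + b) - 1 / y0)"
      by (simp only: e1 e2)
    then show ?thesis by (simp add: sum5 b_def y_def y0_def algebra_simps)
  qed
  have m: "(\<Sum>a<5. c a) = 0" "(\<Sum>a<5. c a * x a) = 0" "(\<Sum>a<5. c a * (x a)\<^sup>2) = 0"
    using g by (simp_all add: sum5 power2_sum power_mult_distrib)
  have x: "0 \<le> x a" if "a \<in> {..<5}" for a
  proof -
    have "a = 0 \<or> a = 1 \<or> a = 2 \<or> a = 3 \<or> a = 4" using that by auto
    then show ?thesis using p r g by auto
  qed
  have s: "(\<Sum>a<5. c a * x a powr q) = (2 powr q - 2) * (p * r) powr (q/2) + p powr q + r powr q - (p + r) powr q" for q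
    using g by (simp add: sum5 powr_mult gp algebra_simps)
  note * = sum_powr_sign_of_resolvent[of "{..<5}" x c q, OF x m res, unfolded s]
  show "1 \<le> q \<Longrightarrow> q \<le> 2 \<Longrightarrow> (p + r) powr q \<le> (2 powr q - 2) * (p * r) powr (q/2) + p powr q + r powr q"
    and "0 < q \<Longrightarrow> q \<le> 1 \<Longrightarrow> (p + r) powr q \<ge> (2 powr q - 2) * (p * r) powr (q/2) + p powr q + r powr q"
    and "2 \<le> q \<Longrightarrow> q \<le> 3 \<Longrightarrow> (p + r) powr q \<ge> (2 powr q - 2) * (p * r) powr (q/2) + p powr q + r powr q"
    using * by simp_all
qed

section \<open>Complex matrices, adjoints and traces\<close>

lemma adjoint_carrier [simp]: "A \<in> carrier_mat n m \<Longrightarrow> mat_adjoint A \<in> carrier_mat m n"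
  by (auto simp: mat_adjoint_def mat_of_rows_def)

lemma adjoint_index [simp]:
  fixes A :: "complex mat"
  shows "i < dim_col A \<Longrightarrow> j < dim_row A \<Longrightarrow> mat_adjoint A $$ (i, j) = cnj (A $$ (j, i))"
  by (simp add: mat_adjoint_def mat_of_rows_def)

lemma adjoint_dim [simp]: "dim_row (mat_adjoint A) = dim_col A" "dim_col (mat_adjoint A) = dim_row A"
  by (simp_all add: mat_adjoint_def)

lemma adjoint_adjoint [simp]: "mat_adjoint (mat_adjoint A) = (A :: complex mat)"
  by (rule eq_matI) auto

lemma adjoint_mult:
  fixes A B :: "complex mat"
  assumes "A \<in> carrier_mat n m" "B \<in> carrier_mat m k"
  shows "mat_adjoint (A * B) = mat_adjoint B * mat_adjoint A"
  using assms by (intro eq_matI) (auto simp: scalar_prod_def mult.commute)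

lemma adjoint_add:
  fixes A B :: "complex mat"
  assumes "A \<in> carrier_mat n m" "B \<in> carrier_mat n m"
  shows "mat_adjoint (A + B) = mat_adjoint A + mat_adjoint B"
  using assms by (intro eq_matI) auto

lemma adjoint_four_block:
  fixes A B C D :: "complex mat"
  assumes "A \<in> carrier_mat n1 m1" "B \<in> carrier_mat n1 m2" "C \<in> carrier_mat n2 m1" "D \<in> carrier_mat n2 m2"
  shows "mat_adjoint (four_block_mat A B C D)
    = four_block_mat (mat_adjoint A) (mat_adjoint C) (mat_adjoint B) (mat_adjoint D)"
  using assms by (intro eq_matI) auto

lemma adjoint_zero [simp]: "mat_adjoint (0\<^sub>m n m :: complex mat) = 0\<^sub>m m n"
  by (rule eq_matI) auto

lemma adjoint_one [simp]: "mat_adjoint (1\<^sub>m n :: complex mat) = 1\<^sub>m n"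
  by (rule eq_matI) auto

definition rdiag :: "nat \<Rightarrow> (nat \<Rightarrow> real) \<Rightarrow> complex mat" where
  "rdiag n d = mat_diag n (\<lambda>i. complex_of_real (d i))"

lemma rdiag_carrier [simp]: "rdiag n d \<in> carrier_mat n n"
  by (simp add: rdiag_def)

lemma rdiag_dim [simp]: "dim_row (rdiag n d) = n" "dim_col (rdiag n d) = n"
  by (simp_all add: rdiag_def mat_diag_def)

lemma rdiag_index [simp]: "i < n \<Longrightarrow> j < n \<Longrightarrow> rdiag n d $$ (i, j) = (if i = j then complex_of_real (d i) else 0)"
  by (simp add: rdiag_def mat_diag_def)

lemma adjoint_rdiag [simp]: "mat_adjoint (rdiag n d) = rdiag n d"
  by (rule eq_matI) auto

lemma rdiag_mult [simp]: "rdiag n c * rdiag n d = rdiag n (\<lambda>i. c i * d i)"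
  by (simp add: rdiag_def)

lemma rdiag_add: "rdiag n c + rdiag n d = rdiag n (\<lambda>i. c i + d i)"
  by (rule eq_matI) auto

lemma rdiag_cong: "(\<And>i. i < n \<Longrightarrow> c i = d i) \<Longrightarrow> rdiag n c = rdiag n d"
  by (rule eq_matI) auto

lemma rdiag_1: "rdiag n (\<lambda>_. 1) = 1\<^sub>m n"
  by (rule eq_matI) auto

lemma rdiag_mult_left_index:
  "A \<in> carrier_mat n m \<Longrightarrow> i < n \<Longrightarrow> j < m \<Longrightarrow> (rdiag n d * A) $$ (i, j) = complex_of_real (d i) * A $$ (i, j)"
  by (simp add: rdiag_def mat_diag_mult_left)

section \<open>Unitary matrices\<close>

definition unitary :: "nat \<Rightarrow> complex mat \<Rightarrow> bool" where
  "unitary n U \<longleftrightarrow> U \<in> carrier_mat n n \<and> mat_adjoint U * U = 1\<^sub>m n \<and> U * mat_adjoint U = 1\<^sub>m n"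

lemma unitaryI:
  assumes "U \<in> carrier_mat n n" "mat_adjoint U * U = 1\<^sub>m n"
  shows "unitary n U"
  unfolding unitary_def using assms mat_mult_left_right_inverse[of "mat_adjoint U" n U] by auto

lemma unitary_carrier: "unitary n U \<Longrightarrow> U \<in> carrier_mat n n"
  by (simp add: unitary_def)

lemma unitary_adjoint: "unitary n U \<Longrightarrow> unitary n (mat_adjoint U)"
  by (auto simp: unitary_def)

lemma unitary_one: "unitary n (1\<^sub>m n)"
  by (auto simp: unitary_def)

lemma mult_carrier_sq: "A \<in> carrier_mat n n \<Longrightarrow> B \<in> carrier_mat n n \<Longrightarrow> A * B \<in> carrier_mat n n"
  by simp

lemma assoc_sq: "A \<in> carrier_mat n n \<Longrightarrow> B \<in> carrier_mat n n \<Longrightarrow> C \<in> carrier_mat n n \<Longrightarrow>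
   (A * B) * C = A * (B * C :: 'a :: semiring_0 mat)"
  by (rule assoc_mult_mat)

lemma adjoint_mult_sq:
  "A \<in> carrier_mat n n \<Longrightarrow> B \<in> carrier_mat n n \<Longrightarrow> mat_adjoint (A * B :: complex mat) = mat_adjoint B * mat_adjoint A"
  by (rule adjoint_mult)

lemma unitary_cancel:
  assumes "unitary n U" "X \<in> carrier_mat n n"
  shows "mat_adjoint U * (U * X) = X" "U * (mat_adjoint U * X) = X"
  using assms assoc_sq[of "mat_adjoint U" n U X] assoc_sq[of U n "mat_adjoint U" X] by (auto simp: unitary_def)

lemma unitary_mult:
  assumes U: "unitary n U" and V: "unitary n V"
  shows "unitary n (U * V)"
proof (rule unitaryI)
  note c = unitary_carrier[OF U] unitary_carrier[OF V]
  show "U * V \<in> carrier_mat n n" using c by simp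
  show "mat_adjoint (U * V) * (U * V) = 1\<^sub>m n"
    using c U V by (simp add: adjoint_mult_sq[of _ n] assoc_sq[where n = n] unitary_cancel[of n]) (simp add: unitary_def)
qed

lemma unitary_row_sum:
  assumes "unitary n U" "i < n"
  shows "(\<Sum>j<n. (cmod (U $$ (i, j)))\<^sup>2) = 1"
proof -
  have c: "U \<in> carrier_mat n n" using assms by (simp add: unitary_def)
  have "(U * mat_adjoint U) $$ (i, i) = 1" using assms by (simp add: unitary_def)
  then have "(\<Sum>j<n. complex_of_real ((cmod (U $$ (i, j)))\<^sup>2)) = 1"
    using c assms by (simp add: scalar_prod_def atLeast0LessThan complex_norm_square del: of_real_power)
  then show ?thesis by (metis of_real_eq_1_iff of_real_sum)
qed

lemma unitary_col_sum:
  assumes "unitary n U" "j < n"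
  shows "(\<Sum>i<n. (cmod (U $$ (i, j)))\<^sup>2) = 1"
  using unitary_row_sum[OF unitary_adjoint[OF assms(1)] assms(2)] assms unitary_carrier[OF assms(1)] by simp

section \<open>Traces\<close>

definition mtrace :: "complex mat \<Rightarrow> complex" where
  "mtrace A = (\<Sum>i<dim_row A. A $$ (i, i))"

lemma mtrace_add: "A \<in> carrier_mat n n \<Longrightarrow> B \<in> carrier_mat n n \<Longrightarrow> mtrace (A + B) = mtrace A + mtrace B"
  by (auto simp: mtrace_def sum.distrib)

lemma mtrace_comm:
  assumes "A \<in> carrier_mat n m" "B \<in> carrier_mat m n"
  shows "mtrace (A * B) = mtrace (B * A)"
proof -
  have "mtrace (A * B) = (\<Sum>i<n. \<Sum>j<m. A $$ (i, j) * B $$ (j, i))"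
    using assms by (simp add: mtrace_def scalar_prod_def atLeast0LessThan)
  also have "\<dots> = (\<Sum>j<m. \<Sum>i<n. B $$ (j, i) * A $$ (i, j))"
    by (subst sum.swap) (simp add: mult.commute)
  also have "\<dots> = mtrace (B * A)"
    using assms by (simp add: mtrace_def scalar_prod_def atLeast0LessThan)
  finally show ?thesis .
qed

lemma mtrace_rdiag: "mtrace (rdiag n d) = complex_of_real (\<Sum>i<n. d i)"
  by (simp add: mtrace_def)

lemma mtrace_conj:
  assumes U: "unitary n U" and A: "A \<in> carrier_mat n n"
  shows "mtrace (U * (A * mat_adjoint U)) = mtrace A"
  using mtrace_comm[of U n n "A * mat_adjoint U"] unitary_carrier[OF U] A U
  by (simp add: assoc_sq[where n = n]) (simp add: unitary_def)

lemma mtrace_gram_rdiag: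
  assumes "V \<in> carrier_mat n n"
  shows "mtrace (mat_adjoint V * (rdiag n d * V)) = complex_of_real (\<Sum>i<n. \<Sum>j<n. d i * (cmod (V $$ (i, j)))\<^sup>2)"
proof -
  have "mtrace (mat_adjoint V * (rdiag n d * V))
      = (\<Sum>j<n. \<Sum>i<n. cnj (V $$ (i, j)) * (rdiag n d * V) $$ (i, j))"
    using assms by (simp add: mtrace_def scalar_prod_def atLeast0LessThan)
  also have "\<dots> = (\<Sum>j<n. \<Sum>i<n. complex_of_real (d i * (cmod (V $$ (i, j)))\<^sup>2))"
    using assms by (simp add: rdiag_mult_left_index complex_norm_square mult.commute mult.left_commute del: index_mult_mat of_real_power)
  also have "\<dots> = (\<Sum>i<n. \<Sum>j<n. complex_of_real (d i * (cmod (V $$ (i, j)))\<^sup>2))"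
    by (rule sum.swap)
  finally show ?thesis by simp
qed

text \<open>In the eigenbasis of one Hermitian matrix, a product trace sees the other only through
  its eigenvalues and the overlaps |U_ij|^2. This gives the mixed term of the second moment of the
  sum and the first moment in the comparison of products.\<close>

lemma mtrace_rdiag_conj:
  assumes U: "U \<in> carrier_mat n n"
  shows "mtrace (rdiag n p * (U * (rdiag n r * mat_adjoint U)))
    = complex_of_real (\<Sum>i<n. \<Sum>j<n. (cmod (U $$ (i, j)))\<^sup>2 * (p i * r j))"
proof -
  have R: "rdiag n r * mat_adjoint U \<in> carrier_mat n n" using U by (intro mult_carrier_sq) simp_all
  have X: "U * (rdiag n r * mat_adjoint U) \<in> carrier_mat n n" using U R by (rule mult_carrier_sq)
  have "(U * (rdiag n r * mat_adjoint U)) $$ (i, i)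
      = (\<Sum>j<n. U $$ (i, j) * (complex_of_real (r j) * cnj (U $$ (i, j))))" if "i < n" for i
  proof -
    have "(U * (rdiag n r * mat_adjoint U)) $$ (i, i)
      = (\<Sum>j<n. U $$ (i, j) * (rdiag n r * mat_adjoint U) $$ (j, i))"
      using U R that by (simp add: scalar_prod_def atLeast0LessThan)
    also have "\<dots> = (\<Sum>j<n. U $$ (i, j) * (complex_of_real (r j) * cnj (U $$ (i, j))))"
      using U that by (intro sum.cong) (auto simp: rdiag_mult_left_index[of _ n n] simp del: index_mult_mat(1))
    finally show ?thesis .
  qed
  then have "mtrace (rdiag n p * (U * (rdiag n r * mat_adjoint U)))
     = (\<Sum>i<n. complex_of_real (p i) * (\<Sum>j<n. U $$ (i, j) * (complex_of_real (r j) * cnj (U $$ (i, j)))))"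
    using rdiag_mult_left_index[OF X] by (simp add: mtrace_def del: index_mult_mat(1))
  then show ?thesis
    by (simp add: sum_distrib_left complex_norm_square mult_ac del: of_real_power)
qed

section \<open>Eigenvalues and the characteristic polynomial\<close>

lemma prod_list_linear_order:
  fixes as :: "complex list"
  shows "order z (\<Prod>a\<leftarrow>as. [:- a, 1:]) = count_list as z"
proof (induction as)
  case (Cons a as)
  have nz: "(\<Prod>a\<leftarrow>as. [:- a, 1:]) \<noteq> 0" by (auto simp: prod_list_zero_iff)
  have "order z [:- a, 1:] = (if a = z then 1 else 0)"
    using order_power_n_n[of a 1] by (auto intro: order_0I)
  then show ?case using nz Cons by (simp add: order_mult del: mult_pCons_left)
qed simp

text \<open>The order of a root z of a product of linear factors is the number of occurrences of z
  in the list, so the sum over distinct roots with multiplicities becomes a sum over the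
  list.\<close>

lemma tr_pow_of_char_poly:
  assumes "char_poly A = (\<Prod>a\<leftarrow>as. [:- a, 1:])"
  shows "tr_pow A p = (\<Sum>a\<leftarrow>as. Re a powr p)"
proof -
  have count: "(\<Sum>z\<in>S. real (count_list as z) * f z) = (\<Sum>a\<leftarrow>as. f a)" if "finite S" "set as \<subseteq> S" for S f
    using that
  proof (induction as)
    case (Cons a as)
    have "(\<Sum>z\<in>S. real (count_list (a # as) z) * f z)
        = (\<Sum>z\<in>S. (if a = z then f z else 0)) + (\<Sum>z\<in>S. real (count_list as z) * f z)"
      unfolding sum.distrib[symmetric] by (intro sum.cong) (auto simp: algebra_simps)
    then show ?case using Cons by simp
  qed simp
  have roots: "{z. poly (\<Prod>a\<leftarrow>as. [:- a, 1:]) z = 0} = set as"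
    by (auto simp: poly_prod_list prod_list_zero_iff)
  show ?thesis
    unfolding tr_pow_def assms roots prod_list_linear_order by (rule count) auto
qed

lemma char_poly_rdiag: "char_poly (rdiag n d) = (\<Prod>a\<leftarrow>map (\<lambda>i. complex_of_real (d i)) [0..<n]. [:- a, 1:])"
proof -
  have "diag_mat (rdiag n d) = map (\<lambda>i. complex_of_real (d i)) [0..<n]"
    by (simp add: diag_mat_def)
  moreover have "upper_triangular (rdiag n d)" by auto
  ultimately show ?thesis using char_poly_upper_triangular[of "rdiag n d" n] by simp
qed

lemma similar_unitary:
  assumes U: "unitary n U" and M: "M \<in> carrier_mat n n"
  shows "similar_mat (U * (M * mat_adjoint U)) M"
proof -
  have "similar_mat_wit (U * (M * mat_adjoint U)) M U (mat_adjoint U)"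
    using U M by (intro similar_mat_witI[where n = n]) (auto simp: unitary_def assoc_sq[where n = n])
  then show ?thesis by (auto simp: similar_mat_def)
qed

lemma tr_pow_conj:
  assumes "unitary n U"
  shows "tr_pow (U * (rdiag n d * mat_adjoint U)) p = (\<Sum>i<n. d i powr p)"
proof -
  have "char_poly (U * (rdiag n d * mat_adjoint U)) = (\<Prod>a\<leftarrow>map (\<lambda>i. complex_of_real (d i)) [0..<n]. [:- a, 1:])"
    using char_poly_similar[OF similar_unitary[OF assms rdiag_carrier]] char_poly_rdiag by simp
  from tr_pow_of_char_poly[OF this] show ?thesis
    by (simp add: comp_def interv_sum_list_conv_sum_set_nat atLeast0LessThan)
qed

lemma det_conj:
  assumes "unitary n U" "M \<in> carrier_mat n n"
  shows "det (U * (M * mat_adjoint U)) = det M"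
  by (rule det_similar[OF similar_unitary[OF assms]])

lemma det_rdiag: "det (rdiag n d) = complex_of_real (\<Prod>i<n. d i)"
proof -
  have "upper_triangular (rdiag n d)" by auto
  from det_upper_triangular[OF this rdiag_carrier] show ?thesis
    by (simp add: prod_list_diag_prod atLeast0LessThan)
qed

text \<open>One block determinant is evaluated in two ways, without inverting anything. The
  generality of an integral domain allows k to be the polynomial variable, which yields
  characteristic polynomials, while k = 1 yields det(1 + XY).\<close>

lemma det_smult_one_minus_mult_swap:
  fixes X Y :: "'a :: idom mat"
  assumes X: "X \<in> carrier_mat n n" and Y: "Y \<in> carrier_mat n n"
  shows "det (k \<cdot>\<^sub>m 1\<^sub>m n - X * Y) = det (k \<cdot>\<^sub>m 1\<^sub>m n - Y * X)"
proof -
  let ?M = "four_block_mat (1\<^sub>m n) X Y (k \<cdot>\<^sub>m 1\<^sub>m n)"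
  let ?N = "four_block_mat (1\<^sub>m n) (- X) (0\<^sub>m n n) (1\<^sub>m n)"
  have M: "?M \<in> carrier_mat (n + n) (n + n)" and N: "?N \<in> carrier_mat (n + n) (n + n)" using X Y by auto
  have comm: "Y * (k \<cdot>\<^sub>m 1\<^sub>m n) = (k \<cdot>\<^sub>m 1\<^sub>m n) * Y"
    unfolding mult_smult_distrib[OF Y one_carrier_mat] mult_smult_assoc_mat[OF one_carrier_mat Y] using Y by simp
  have "det ?M = det (1\<^sub>m n * (k \<cdot>\<^sub>m 1\<^sub>m n) - X * Y)"
    by (rule det_four_block_mat) (use X Y comm in auto)
  also have "1\<^sub>m n * (k \<cdot>\<^sub>m 1\<^sub>m n :: 'a mat) = k \<cdot>\<^sub>m 1\<^sub>m n" by simp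
  finally have 1: "det ?M = det (k \<cdot>\<^sub>m 1\<^sub>m n - X * Y)" .
  \<comment> \<open>Column elimination by the unit triangular \<open>?N\<close> clears the upper
    right block, so the second evaluation reads off the diagonal blocks.\<close>
  have "?M * ?N = four_block_mat (1\<^sub>m n) (0\<^sub>m n n) Y (k \<cdot>\<^sub>m 1\<^sub>m n - Y * X)"
  proof (subst mult_four_block_mat[OF one_carrier_mat X Y smult_carrier_mat[OF one_carrier_mat] one_carrier_mat _ zero_carrier_mat one_carrier_mat])
    show "- X \<in> carrier_mat n n" using X by simp
    show "four_block_mat (1\<^sub>m n * 1\<^sub>m n + X * 0\<^sub>m n n) (1\<^sub>m n * - X + X * 1\<^sub>m n)
       (Y * 1\<^sub>m n + k \<cdot>\<^sub>m 1\<^sub>m n * 0\<^sub>m n n) (Y * - X + k \<cdot>\<^sub>m 1\<^sub>m n * 1\<^sub>m n)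
     = four_block_mat (1\<^sub>m n) (0\<^sub>m n n) Y (k \<cdot>\<^sub>m 1\<^sub>m n - Y * X)"
    proof (rule cong_four_block_mat)
      show "1\<^sub>m n * - X + X * 1\<^sub>m n = 0\<^sub>m n n" using X by (intro eq_matI) auto
      show "Y * - X + k \<cdot>\<^sub>m 1\<^sub>m n * 1\<^sub>m n = k \<cdot>\<^sub>m 1\<^sub>m n - Y * X" using X Y by (intro eq_matI) auto
    qed (use X Y in auto)
  qed
  then have "det ?M * det ?N = det (four_block_mat (1\<^sub>m n) (0\<^sub>m n n) Y (k \<cdot>\<^sub>m 1\<^sub>m n - Y * X))"
    using det_mult[OF M N] by simp
  also have "\<dots> = det (1\<^sub>m n :: 'a mat) * det (k \<cdot>\<^sub>m 1\<^sub>m n - Y * X)"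
    by (rule det_four_block_mat_upper_right_zero[where n = n and m = n]) (use X Y in \<open>auto intro!: minus_carrier_mat\<close>)
  finally have "det ?M * det ?N = det (k \<cdot>\<^sub>m 1\<^sub>m n - Y * X)" by simp
  moreover have "det ?N = 1"
    using det_four_block_mat_lower_left_zero[of "1\<^sub>m n" n "- X" n "0\<^sub>m n n" "1\<^sub>m n :: 'a mat"] X by simp
  ultimately show ?thesis using 1 by simp
qed

lemma char_poly_mult_swap:
  fixes X Y :: "complex mat"
  assumes X: "X \<in> carrier_mat n n" and Y: "Y \<in> carrier_mat n n"
  shows "char_poly (X * Y) = char_poly (Y * X)"
proof -
  define l where "l = map_mat (\<lambda>x :: complex. [:x:])"
  have l_mult: "l (A * B) = l A * l B" if "A \<in> carrier_mat n n" "B \<in> carrier_mat n n" for A B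
  proof -
    interpret h: comm_ring_hom "\<lambda>x :: complex. [:x:]" by unfold_locales auto
    show ?thesis unfolding l_def using that by (rule h.mat_hom_mult)
  qed
  have "char_poly_matrix (A * B) = [:0, 1:] \<cdot>\<^sub>m 1\<^sub>m n - l A * l B"
    if A: "A \<in> carrier_mat n n" and B: "B \<in> carrier_mat n n" for A B
    unfolding l_mult[OF A B, symmetric] using A B unfolding char_poly_matrix_def l_def
    by (intro eq_matI) auto
  then show ?thesis
    using assms det_smult_one_minus_mult_swap[of "l X" n "l Y" "[:0, 1:]"]
    by (simp add: char_poly_def l_def)
qed

lemma tr_pow_mult_swap:
  "X \<in> carrier_mat n n \<Longrightarrow> Y \<in> carrier_mat n n \<Longrightarrow> tr_pow (X * Y) p = tr_pow (Y * X) p"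
  unfolding tr_pow_def by (simp add: char_poly_mult_swap)

text \<open>Padding by zero blocks only adds eigenvalues 0, and \<open>0 powr p\<close> is 0 for
  every p. Hence all blocks can be treated as square matrices of one common size.\<close>

lemma tr_pow_four_block_zero:
  assumes B: "B \<in> carrier_mat n n"
  shows "tr_pow (four_block_mat B (0\<^sub>m n m) (0\<^sub>m m n) (0\<^sub>m m m)) p = tr_pow B p"
    and "tr_pow (four_block_mat (0\<^sub>m m m) (0\<^sub>m m n) (0\<^sub>m n m) B) p = tr_pow B p"
proof -
  have "rdiag m (\<lambda>_. 0) = 0\<^sub>m m m" by (rule eq_matI) auto
  then have z: "char_poly (0\<^sub>m m m :: complex mat) = (\<Prod>a\<leftarrow>replicate m 0. [:- a, 1:])"
    using char_poly_rdiag[of m "\<lambda>_. 0"] by (simp add: map_replicate_const comp_def del: mult_pCons_left)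
  obtain as where as: "char_poly B = (\<Prod>a\<leftarrow>as. [:- a, 1:])" using char_poly_factorized[OF B] by blast
  have ex: "\<exists>es. char_poly B = (\<Prod>a\<leftarrow>es. [:- a, 1:])"
    "\<exists>es. char_poly (0\<^sub>m m m :: complex mat) = (\<Prod>a\<leftarrow>es. [:- a, 1:])"
    by (rule exI, rule as) (rule exI, rule z)
  have s0: "(\<Sum>a\<leftarrow>replicate m (0 :: complex). Re a powr p) = 0" by (simp add: sum_list_replicate)
  have "char_poly (four_block_mat B (0\<^sub>m n m) (0\<^sub>m m n) (0\<^sub>m m m)) = char_poly B * char_poly (0\<^sub>m m m)"
    by (rule char_poly_0_block[OF refl ex]) (use B in auto)
  then have "char_poly (four_block_mat B (0\<^sub>m n m) (0\<^sub>m m n) (0\<^sub>m m m)) = (\<Prod>a\<leftarrow>as @ replicate m 0. [:- a, 1:])"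
    using as z by simp
  from tr_pow_of_char_poly[OF this, of p] show "tr_pow (four_block_mat B (0\<^sub>m n m) (0\<^sub>m m n) (0\<^sub>m m m)) p = tr_pow B p"
    unfolding tr_pow_of_char_poly[OF as] map_append sum_list_append s0 by simp
  have "char_poly (four_block_mat (0\<^sub>m m m) (0\<^sub>m m n) (0\<^sub>m n m) B) = char_poly (0\<^sub>m m m) * char_poly B"
    by (rule char_poly_0_block[OF refl ex(2,1)]) (use B in auto)
  then have "char_poly (four_block_mat (0\<^sub>m m m) (0\<^sub>m m n) (0\<^sub>m n m) B) = (\<Prod>a\<leftarrow>replicate m 0 @ as. [:- a, 1:])"
    using as z by simp
  from tr_pow_of_char_poly[OF this, of p] show "tr_pow (four_block_mat (0\<^sub>m m m) (0\<^sub>m m n) (0\<^sub>m n m) B) p = tr_pow B p"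
    unfolding tr_pow_of_char_poly[OF as] map_append sum_list_append s0 by simp
qed

section \<open>Diagonalisation of Hermitian matrices\<close>

lemma mult_index_sum:
  assumes "A \<in> carrier_mat n m" "B \<in> carrier_mat m k" "i < n" "j < k"
  shows "(A * B) $$ (i, j) = (\<Sum>l<m. A $$ (i, l) * B $$ (l, j))"
  using assms by (simp add: scalar_prod_def atLeast0LessThan)

text \<open>Gram-Schmidt delivers nonzero orthogonal columns that are not normalised. Rescaling each
  column by a positive number makes the matrix unitary and keeps an eigenvector in the first column
  an eigenvector.\<close>

lemma corthogonal_normalize:
  fixes W0 :: "complex mat"
  assumes W0: "W0 \<in> carrier_mat n n" and orth: "corthogonal_mat W0"
  obtains c where "\<And>i. i < n \<Longrightarrow> 0 < c i" "unitary n (W0 * rdiag n c)"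
proof -
  define D where "D = mat_adjoint W0 * W0"
  define d where "d = (\<lambda>i. \<Sum>k<n. (cmod (W0 $$ (k, i)))\<^sup>2)"
  have D: "D \<in> carrier_mat n n" using W0 by (simp add: D_def mult_carrier_sq[where n = n])
  have off: "D $$ (i, j) = 0" if "i < n" "j < n" "i \<noteq> j" for i j
    using orth that W0 by (auto simp: corthogonal_mat_def D_def Let_def diagonal_mat_def)
  have diag: "D $$ (i, i) = complex_of_real (d i)" if "i < n" for i
    using W0 that by (simp add: D_def d_def scalar_prod_def atLeast0LessThan complex_norm_square mult.commute del: of_real_power)
  have d0: "0 < d i" if "i < n" for i
  proof -
    have "d i \<noteq> 0" using orth that W0 diag[OF that] by (auto simp: corthogonal_mat_def D_def Let_def)
    moreover have "0 \<le> d i" by (simp add: d_def sum_nonneg)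
    ultimately show ?thesis by simp
  qed
  have Deq: "D = rdiag n d" using D off diag by (intro eq_matI) auto
  define c where "c = (\<lambda>i. 1 / sqrt (d i))"
  have "mat_adjoint (W0 * rdiag n c) * (W0 * rdiag n c) = rdiag n c * (D * rdiag n c)"
    using W0 by (simp add: adjoint_mult_sq[where n = n] assoc_sq[where n = n] mult_carrier_sq[where n = n] D_def)
  also have "\<dots> = rdiag n (\<lambda>i. c i * (d i * c i))" by (simp add: Deq)
  also have "\<dots> = rdiag n (\<lambda>_. 1)"
  proof (rule rdiag_cong)
    fix i assume "i < n"
    then show "c i * (d i * c i) = 1"
      using d0[of i] real_sqrt_mult_self[of "d i"] by (simp add: c_def field_simps)
  qed
  finally have "unitary n (W0 * rdiag n c)"
    using W0 by (intro unitaryI) (simp_all add: rdiag_1 mult_carrier_sq[where n = n])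
  moreover have "0 < c i" if "i < n" for i using d0[OF that] by (simp add: c_def)
  ultimately show thesis using that by blast
qed

text \<open>Deflation: an eigenvector is completed to a unitary \<open>W\<close>. In the new basis
  the first column is e times the first unit vector, Hermitian symmetry makes e real and clears the
  rest of the first row, and the induction hypothesis handles the remaining block.\<close>

theorem hermitian_diagonalizable:
  fixes A :: "complex mat"
  assumes "A \<in> carrier_mat n n" "mat_adjoint A = A"
  shows "\<exists>U d. unitary n U \<and> A = U * (rdiag n d * mat_adjoint U)"
  using assms
proof (induction n arbitrary: A)
  case 0
  have "A = 1\<^sub>m 0 * (rdiag 0 (\<lambda>_. 0) * mat_adjoint (1\<^sub>m 0))"
    using 0 by (intro eq_matI) auto
  then show ?case using unitary_one[of 0] by blast
next
  case (Suc n)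
  let ?N = "Suc n"
  note A = Suc.prems(1) and herm = Suc.prems(2)
  obtain es where es: "char_poly A = (\<Prod>a\<leftarrow>es. [:- a, 1:])" "length es = ?N"
    using char_poly_factorized[OF A] by blast
  then obtain e es' where "es = e # es'" by (cases es) auto
  then have "eigenvalue A e" using es by (simp add: eigenvalue_root_char_poly[OF A])
  then obtain v where v: "v \<in> carrier_vec ?N" "v \<noteq> 0\<^sub>v ?N" "A *\<^sub>v v = e \<cdot>\<^sub>v v"
    using A by (auto simp: eigenvalue_def eigenvector_def)
  interpret cof_vec_space ?N "TYPE(complex)" .
  define b where "b = basis_completion v"
  define ws where "ws = gram_schmidt ?N b"
  define W0 where "W0 = mat_of_cols ?N ws"
  note bc = basis_completion[OF v(1,2), folded b_def]
  obtain vs where bv: "b = v # vs" using bc(6,7) by (cases b) auto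
  have hdws: "hd ws = v" using gram_schmidt_hd[OF v(1), of vs] by (simp add: ws_def bv)
  note gs = gram_schmidt_result[OF bc(2,4,5) ws_def]
  have len: "length ws = ?N" using gs(4) bc(6) by simp
  have W0: "W0 \<in> carrier_mat ?N ?N" using len by (simp add: W0_def mat_of_cols_carrier(1)[of ?N ws, unfolded len])
  have "corthogonal_mat W0" unfolding W0_def by (rule orthogonal_mat_of_cols[OF gs(3,2) len])
  from corthogonal_normalize[OF W0 this] obtain c where
    c: "\<And>i. i < ?N \<Longrightarrow> 0 < c i" and uni: "unitary ?N (W0 * rdiag ?N c)" by blast
  define W where "W = W0 * rdiag ?N c"
  have W: "unitary ?N W" using uni by (simp add: W_def)
  then have Wc: "W \<in> carrier_mat ?N ?N" by (rule unitary_carrier)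
  have W0_0: "W0 $$ (i, 0) = v $ i" if "i < ?N" for i
    using that len hdws by (simp add: W0_def mat_of_cols_def hd_conv_nth flip: length_greater_0_conv)
  have W_0: "W $$ (i, 0) = complex_of_real (c 0) * v $ i" if "i < ?N" for i
    using that W0 W0_0 unfolding W_def rdiag_def
    by (simp add: mat_diag_mult_right[of _ ?N] mult.commute)
  have AW_0: "(A * W) $$ (i, 0) = e * W $$ (i, 0)" if i: "i < ?N" for i
  proof -
    have "(A * W) $$ (i, 0) = (\<Sum>k<?N. A $$ (i, k) * W $$ (k, 0))"
      by (rule mult_index_sum[OF A Wc i]) simp
    also have "\<dots> = complex_of_real (c 0) * (\<Sum>k<?N. A $$ (i, k) * v $ k)"
      unfolding sum_distrib_left by (intro sum.cong) (auto simp: W_0)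
    also have "(\<Sum>k<?N. A $$ (i, k) * v $ k) = (A *\<^sub>v v) $ i"
      using A v(1) i by (simp add: scalar_prod_def atLeast0LessThan)
    also have "\<dots> = e * v $ i" using v i by simp
    finally show ?thesis using W_0[OF i] by simp
  qed
  define A' where "A' = mat_adjoint W * (A * W)"
  have A': "A' \<in> carrier_mat ?N ?N" using A Wc by (simp add: A'_def mult_carrier_sq[where n = ?N])
  have hermA': "mat_adjoint A' = A'"
    using A Wc herm by (simp add: A'_def adjoint_mult_sq[where n = ?N] assoc_sq[where n = ?N] mult_carrier_sq[where n = ?N])
  have A'_col: "A' $$ (i, 0) = (if i = 0 then e else 0)" if i: "i < ?N" for i
  proof -
    have "A' $$ (i, 0) = (\<Sum>k<?N. mat_adjoint W $$ (i, k) * (A * W) $$ (k, 0))"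
      unfolding A'_def by (rule mult_index_sum[OF adjoint_carrier[OF Wc] mult_carrier_sq[OF A Wc] i]) simp
    also have "\<dots> = e * (\<Sum>k<?N. mat_adjoint W $$ (i, k) * W $$ (k, 0))"
      unfolding sum_distrib_left by (intro sum.cong refl) (simp add: AW_0 mult.left_commute del: index_mult_mat)
    also have "(\<Sum>k<?N. mat_adjoint W $$ (i, k) * W $$ (k, 0)) = (mat_adjoint W * W) $$ (i, 0)"
      by (rule mult_index_sum[OF adjoint_carrier[OF Wc] Wc i, symmetric]) simp
    also have "\<dots> = (if i = 0 then 1 else 0)" using W i by (simp add: unitary_def)
    finally show ?thesis by simp
  qed
  have sym: "A' $$ (i, j) = cnj (A' $$ (j, i))" if "i < ?N" "j < ?N" for i j
    using arg_cong[OF hermA', of "\<lambda>M. M $$ (i, j)"] A' that by simp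
  have e_real: "e = complex_of_real (Re e)"
    using sym[of 0 0] A'_col[of 0] by (simp add: complex_eq_iff)
  define A3 where "A3 = Matrix.mat n n (\<lambda>(i, j). A' $$ (Suc i, Suc j))"
  have A3: "A3 \<in> carrier_mat n n" by (simp add: A3_def)
  have "mat_adjoint A3 = A3"
    by (rule eq_matI) (use A3 in \<open>auto simp: A3_def sym[symmetric]\<close>)
  from Suc.IH[OF A3 this] obtain U3 d3 where U3: "unitary n U3" and A3_eq: "A3 = U3 * (rdiag n d3 * mat_adjoint U3)"
    by blast
  have U3c: "U3 \<in> carrier_mat n n" using U3 by (rule unitary_carrier)
  define d where "d = (\<lambda>i. case i of 0 \<Rightarrow> Re e | Suc k \<Rightarrow> d3 k)"
  define R where "R = four_block_mat (1\<^sub>m 1) (0\<^sub>m 1 n) (0\<^sub>m n 1) U3"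
  have Rc: "R \<in> carrier_mat ?N ?N"
    using four_block_carrier_mat[OF one_carrier_mat[of 1] U3c] by (simp add: R_def)
  have R_adj: "mat_adjoint R = four_block_mat (1\<^sub>m 1) (0\<^sub>m 1 n) (0\<^sub>m n 1) (mat_adjoint U3)"
    using adjoint_four_block[OF one_carrier_mat[of 1] zero_carrier_mat[of 1 n] zero_carrier_mat[of n 1] U3c]
    by (simp add: R_def)
  have blk: "four_block_mat X (0\<^sub>m 1 n) (0\<^sub>m n 1) Y * four_block_mat X' (0\<^sub>m 1 n) (0\<^sub>m n 1) Y'
      = four_block_mat (X * X') (0\<^sub>m 1 n) (0\<^sub>m n 1) (Y * Y')"
    if "X \<in> carrier_mat 1 1" "X' \<in> carrier_mat 1 1" "Y \<in> carrier_mat n n" "Y' \<in> carrier_mat n n"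
    for X X' Y Y' :: "complex mat"
    using that
    by (subst mult_four_block_mat[where ?nr1.0 = 1 and ?n1.0 = 1 and ?n2.0 = n and ?nr2.0 = n and ?nc1.0 = 1 and ?nc2.0 = n]) auto
  have R: "unitary ?N R"
  proof (rule unitaryI[OF Rc])
    have "mat_adjoint R * R = four_block_mat (1\<^sub>m 1) (0\<^sub>m 1 n) (0\<^sub>m n 1) (1\<^sub>m n)"
      unfolding R_adj unfolding R_def using U3 U3c by (subst blk) (auto simp: unitary_def)
    then show "mat_adjoint R * R = 1\<^sub>m ?N" by simp
  qed
  have rd: "rdiag ?N d = four_block_mat (rdiag 1 (\<lambda>_. Re e)) (0\<^sub>m 1 n) (0\<^sub>m n 1) (rdiag n d3)"
    by (rule eq_matI) (auto simp: d_def split: nat.splits)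
  have "A' = four_block_mat (rdiag 1 (\<lambda>_. Re e)) (0\<^sub>m 1 n) (0\<^sub>m n 1) A3"
  proof (rule eq_matI)
    fix i j assume "i < dim_row (four_block_mat (rdiag 1 (\<lambda>_. Re e)) (0\<^sub>m 1 n) (0\<^sub>m n 1) A3)"
      "j < dim_col (four_block_mat (rdiag 1 (\<lambda>_. Re e)) (0\<^sub>m 1 n) (0\<^sub>m n 1) A3)"
    then have ij: "i < ?N" "j < ?N" using A3 by auto
    have "A' $$ (0, j) = 0" if "j \<noteq> 0" using sym[of 0 j] A'_col[of j] ij that by simp
    then show "A' $$ (i, j) = four_block_mat (rdiag 1 (\<lambda>_. Re e)) (0\<^sub>m 1 n) (0\<^sub>m n 1) A3 $$ (i, j)"
      using ij A3 A'_col[OF ij(1)] e_real by (cases i; cases j) (auto simp: A3_def)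
  qed (use A' A3 in auto)
  also have "\<dots> = R * (rdiag ?N d * mat_adjoint R)"
    unfolding R_adj rd unfolding R_def A3_eq
      blk[OF rdiag_carrier one_carrier_mat rdiag_carrier adjoint_carrier[OF U3c]]
      blk[OF one_carrier_mat mult_carrier_sq[OF rdiag_carrier one_carrier_mat] U3c
        mult_carrier_sq[OF rdiag_carrier adjoint_carrier[OF U3c]]]
    by simp
  finally have A'_eq: "A' = R * (rdiag ?N d * mat_adjoint R)" .
  have "W * (A' * mat_adjoint W) = A"
    using A Wc W unitary_cancel(2)[OF W]
    by (simp add: A'_def assoc_sq[where n = ?N] mult_carrier_sq[where n = ?N]) (simp add: unitary_def)
  then have "A = (W * R) * (rdiag ?N d * mat_adjoint (W * R))"
    using Wc Rc by (simp add: A'_eq adjoint_mult_sq[where n = ?N] assoc_sq[where n = ?N] mult_carrier_sq[where n = ?N])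
  then show ?case using unitary_mult[OF W R] by blast
qed

section \<open>Eigenvalues of a sum of two Hermitian matrices\<close>

lemma rdiag_mult_assoc:
  "X \<in> carrier_mat n n \<Longrightarrow> rdiag n c * (rdiag n d * X) = rdiag n (\<lambda>i. c i * d i) * X"
  by (simp add: assoc_sq[where n = n, symmetric])

lemma sandwich_add:
  fixes A B X Y :: "complex mat"
  assumes "X \<in> carrier_mat n n" "A \<in> carrier_mat n n" "B \<in> carrier_mat n n" "Y \<in> carrier_mat n n"
  shows "X * ((A + B) * Y) = X * (A * Y) + X * (B * Y)"
  using add_mult_distrib_mat[OF assms(2-4)]
    mult_add_distrib_mat[OF assms(1) mult_carrier_sq[OF assms(2,4)] mult_carrier_sq[OF assms(3,4)]]
  by simp

lemma mtrace_adjoint_mult: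
  assumes "U \<in> carrier_mat n n" "V \<in> carrier_mat n n"
  shows "mtrace (mat_adjoint U * V) = (\<Sum>i<n. \<Sum>j<n. cnj (U $$ (i, j)) * V $$ (i, j))"
proof -
  have "mtrace (mat_adjoint U * V) = (\<Sum>j<n. \<Sum>i<n. cnj (U $$ (i, j)) * V $$ (i, j))"
    using assms by (simp add: mtrace_def scalar_prod_def atLeast0LessThan)
  then show ?thesis by (subst sum.swap)
qed

text \<open>This is |u - x v|^2 \<ge> 0 expanded and divided by x, with equality at v = u/x.\<close>

lemma young_complex:
  fixes u v :: complex and x :: real
  assumes "x > 0"
  shows "2 * Re (cnj u * v) - x * (cmod v)\<^sup>2 \<le> (cmod u)\<^sup>2 / x"
proof -
  have "0 \<le> (Re u - x * Re v)\<^sup>2 + (Im u - x * Im v)\<^sup>2" by simp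
  also have "\<dots> = ((Re u)\<^sup>2 + (Im u)\<^sup>2) - 2 * x * (Re u * Re v + Im u * Im v) + x\<^sup>2 * ((Re v)\<^sup>2 + (Im v)\<^sup>2)"
    by (simp add: power2_eq_square algebra_simps)
  also have "\<dots> = (cmod u)\<^sup>2 - 2 * x * Re (cnj u * v) + x\<^sup>2 * (cmod v)\<^sup>2"
    unfolding cmod_power2 by simp
  finally have "0 \<le> ((cmod u)\<^sup>2 - 2 * x * Re (cnj u * v) + x\<^sup>2 * (cmod v)\<^sup>2) / x"
    using assms by (intro divide_nonneg_pos)
  also have "\<dots> = (cmod u)\<^sup>2 / x - 2 * Re (cnj u * v) + x * (cmod v)\<^sup>2"
    using assms by (simp add: add_divide_distrib diff_divide_distrib power2_eq_square)
  finally show ?thesis by simp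
qed

text \<open>The eigenbasis of the first summand serves as coordinate system. The columns of
  \<open>U\<close> are then the eigenvectors of the second summand in these coordinates, and those
  of \<open>Z\<close> the eigenvectors of the sum.\<close>

locale diag_sum =
  fixes n :: nat and p r s :: "nat \<Rightarrow> real" and U Z :: "complex mat"
  assumes U: "unitary n U" and Z: "unitary n Z"
    and eq: "rdiag n p + U * (rdiag n r * mat_adjoint U) = Z * (rdiag n s * mat_adjoint Z)"
begin

definition w :: "nat \<Rightarrow> nat \<Rightarrow> real" where
  "w i j = (cmod (U $$ (i, j)))\<^sup>2"

lemma w_nonneg: "0 \<le> w i j"
  by (simp add: w_def)

lemma w_row: "i < n \<Longrightarrow> (\<Sum>j<n. w i j) = 1"
  using unitary_row_sum[OF U] by (simp add: w_def)

lemma w_col: "j < n \<Longrightarrow> (\<Sum>i<n. w i j) = 1"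
  using unitary_col_sum[OF U] by (simp add: w_def)

lemma w_sum_left: "(\<Sum>i<n. \<Sum>j<n. w i j * f i) = (\<Sum>i<n. f i)"
  by (simp add: sum_distrib_right[symmetric] w_row)

lemma w_sum_right: "(\<Sum>i<n. \<Sum>j<n. w i j * f j) = (\<Sum>j<n. f j)"
  by (subst sum.swap) (simp add: sum_distrib_right[symmetric] w_col)

lemma carr: "U \<in> carrier_mat n n" "Z \<in> carrier_mat n n"
  "mat_adjoint U \<in> carrier_mat n n" "mat_adjoint Z \<in> carrier_mat n n"
  using U Z by (auto simp: unitary_def)

lemmas alg = assoc_sq[where n = n] adjoint_mult_sq[where n = n] mult_carrier_sq[where n = n]
  unitary_cancel[OF U] unitary_cancel[OF Z] rdiag_mult_assoc

text \<open>The bound $|u|^2/x \ge 2\,\mathrm{Re}(\bar u v) - x|v|^2$ is summed over all entries, with $u$ running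
  through the entries of $U$ and $v$ through those of $(S+t)^{-1}U$, where $S$ is the matrix sum.\<close>

lemma resolvent_le:
  assumes s: "\<And>k. k < n \<Longrightarrow> 0 < s k + t"
    and pr: "\<And>i j. i < n \<Longrightarrow> j < n \<Longrightarrow> 0 < p i + r j + t"
  shows "(\<Sum>k<n. 1 / (s k + t)) \<le> (\<Sum>i<n. \<Sum>j<n. w i j / (p i + r j + t))"
proof -
  \<comment> \<open>These are the eigenvalues of the resolvent, so \<open>W\<close> below is the
    inverse of S + t.\<close>
  define e where "e = (\<lambda>k. 1 / (s k + t))"
  define W where "W = Z * (rdiag n e * mat_adjoint Z)"
  define V where "V = W * U"
  define Q where "Q = U * (rdiag n r * mat_adjoint U)"
  have W: "W \<in> carrier_mat n n" "mat_adjoint W = W"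
    using carr by (simp_all add: W_def alg)
  have V: "V \<in> carrier_mat n n" and Q: "Q \<in> carrier_mat n n"
    using W carr by (simp_all add: V_def Q_def alg)
  have trW: "mtrace W = complex_of_real (\<Sum>k<n. e k)"
    unfolding W_def using mtrace_conj[OF Z, of "rdiag n e"] by (simp add: mtrace_rdiag)
  have conjU: "mtrace (mat_adjoint U * (A * U)) = mtrace A" if "A \<in> carrier_mat n n" for A
    using mtrace_conj[OF unitary_adjoint[OF U] that] by simp
  have "mtrace (mat_adjoint U * V) = complex_of_real (\<Sum>k<n. e k)"
    unfolding V_def using conjU W trW by simp
  then have lin: "(\<Sum>i<n. \<Sum>j<n. Re (cnj (U $$ (i, j)) * V $$ (i, j))) = (\<Sum>k<n. e k)"
    using arg_cong[of _ _ Re, OF mtrace_adjoint_mult[OF carr(1) V]] by (simp only: Re_sum Re_complex_of_real)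
  have "rdiag n p + Q + rdiag n (\<lambda>_. t) = Z * (rdiag n (\<lambda>k. s k + t) * mat_adjoint Z)"
  proof -
    have "Z * (rdiag n (\<lambda>_. t) * mat_adjoint Z) = rdiag n (\<lambda>_. t)"
    proof -
      have "rdiag n (\<lambda>_. t) * mat_adjoint Z = complex_of_real t \<cdot>\<^sub>m mat_adjoint Z"
        using carr by (intro eq_matI) (simp_all add: rdiag_mult_left_index[of _ n n] del: index_mult_mat(1))
      then have "Z * (rdiag n (\<lambda>_. t) * mat_adjoint Z) = complex_of_real t \<cdot>\<^sub>m 1\<^sub>m n"
        using mult_smult_distrib[OF carr(2,4)] Z by (simp add: unitary_def)
      also have "\<dots> = rdiag n (\<lambda>_. t)" by (rule eq_matI) auto
      finally show ?thesis .
    qed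
    moreover have "Z * (rdiag n (\<lambda>k. s k + t) * mat_adjoint Z)
        = Z * (rdiag n s * mat_adjoint Z) + Z * (rdiag n (\<lambda>_. t) * mat_adjoint Z)"
      unfolding rdiag_add[symmetric] by (rule sandwich_add[OF carr(2) rdiag_carrier rdiag_carrier carr(4)])
    ultimately show ?thesis using eq by (simp add: Q_def)
  qed
  \<comment> \<open>The identity W (S+t) W = W makes the quadratic term of the variational bound
    equal to tr W.\<close>
  then have "W * ((rdiag n p + Q + rdiag n (\<lambda>_. t)) * W) = Z * (rdiag n (\<lambda>k. e k * ((s k + t) * e k)) * mat_adjoint Z)"
    using carr by (simp add: W_def alg)
  also have "rdiag n (\<lambda>k. e k * ((s k + t) * e k)) = rdiag n e"
    using s by (intro rdiag_cong) (force simp: e_def)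
  finally have "W * ((rdiag n p + Q + rdiag n (\<lambda>_. t)) * W) = W" by (simp add: W_def)
  moreover have "W * ((rdiag n p + Q + rdiag n (\<lambda>_. t)) * W) = W * (rdiag n p * W) + W * (Q * W) + W * (rdiag n (\<lambda>_. t) * W)"
    using W Q by (simp add: sandwich_add[where n = n])
  ultimately have "mtrace (W * (rdiag n p * W) + W * (Q * W) + W * (rdiag n (\<lambda>_. t) * W)) = mtrace W"
    by simp
  then have "mtrace (W * (rdiag n p * W)) + mtrace (W * (Q * W)) + mtrace (W * (rdiag n (\<lambda>_. t) * W)) = mtrace W"
    using W Q by (simp add: mtrace_add[of _ n] mult_carrier_sq[where n = n])
  \<comment> \<open>Since \<open>V = W * U\<close> and \<open>U\<close> diagonalises
    \<open>Q\<close>, the numbers p_i weight the rows of \<open>V\<close> and the r_j weight its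
    columns. The entry (i, j) thus receives the total weight p_i + r_j + t.\<close>
  moreover have "mtrace (mat_adjoint V * (rdiag n d * V)) = mtrace (W * (rdiag n d * W))" for d
    using conjU[of "W * (rdiag n d * W)"] W carr by (simp add: V_def alg)
  moreover have "V * (rdiag n r * mat_adjoint V) = W * (Q * W)"
    using W carr by (simp add: V_def Q_def alg)
  ultimately have "mtrace (mat_adjoint V * (rdiag n p * V)) + mtrace (mat_adjoint (mat_adjoint V) * (rdiag n r * mat_adjoint V))
     + mtrace (mat_adjoint V * (rdiag n (\<lambda>_. t) * V)) = mtrace W" by simp
  then have "(\<Sum>i<n. \<Sum>j<n. p i * (cmod (V $$ (i, j)))\<^sup>2) + (\<Sum>i<n. \<Sum>j<n. r i * (cmod (mat_adjoint V $$ (i, j)))\<^sup>2)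
     + (\<Sum>i<n. \<Sum>j<n. t * (cmod (V $$ (i, j)))\<^sup>2) = (\<Sum>k<n. e k)"
    unfolding trW mtrace_gram_rdiag[OF V] mtrace_gram_rdiag[OF adjoint_carrier[OF V]]
    by (simp only: of_real_add[symmetric] of_real_eq_iff)
  moreover have "(\<Sum>i<n. \<Sum>j<n. r i * (cmod (mat_adjoint V $$ (i, j)))\<^sup>2) = (\<Sum>i<n. \<Sum>j<n. r j * (cmod (V $$ (i, j)))\<^sup>2)"
    using V by (subst sum.swap) (auto intro!: sum.cong)
  ultimately have quad: "(\<Sum>i<n. \<Sum>j<n. (p i + r j + t) * (cmod (V $$ (i, j)))\<^sup>2) = (\<Sum>k<n. e k)"
    by (simp add: sum.distrib distrib_right)
  \<comment> \<open>Twice the linear term minus the quadratic term is 2 tr W - tr W = tr W, ready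
    for the entrywise bound.\<close>
  have "(\<Sum>k<n. e k) = (\<Sum>i<n. \<Sum>j<n. 2 * Re (cnj (U $$ (i, j)) * V $$ (i, j)) - (p i + r j + t) * (cmod (V $$ (i, j)))\<^sup>2)"
    using lin quad by (simp only: sum_subtractf sum_distrib_left[symmetric])
  also have "\<dots> \<le> (\<Sum>i<n. \<Sum>j<n. w i j / (p i + r j + t))"
    unfolding w_def by (intro sum_mono young_complex pr) auto
  finally show ?thesis by (simp add: e_def)
qed

lemma sum_eigenvalues: "(\<Sum>k<n. s k) = (\<Sum>i<n. p i) + (\<Sum>j<n. r j)"
proof -
  have "mtrace (rdiag n p) + mtrace (U * (rdiag n r * mat_adjoint U)) = mtrace (Z * (rdiag n s * mat_adjoint Z))"
    unfolding eq[symmetric] using carr by (simp add: mtrace_add[of _ n] alg)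
  then have "complex_of_real ((\<Sum>i<n. p i) + (\<Sum>j<n. r j)) = complex_of_real (\<Sum>k<n. s k)"
    by (simp add: mtrace_conj[OF U] mtrace_conj[OF Z] mtrace_rdiag)
  then show ?thesis by (metis of_real_eq_iff)
qed

text \<open>Both sides expand to tr P^2 + 2 tr PQ + tr Q^2. Cyclicity of the trace identifies PQ
  with QP, so noncommutativity is invisible at this order.\<close>

lemma sum_eigenvalues_square:
  "(\<Sum>k<n. (s k)\<^sup>2) = (\<Sum>i<n. \<Sum>j<n. w i j * (p i + r j)\<^sup>2)"
proof -
  define P where "P = rdiag n p"
  define Q where "Q = U * (rdiag n r * mat_adjoint U)"
  have PQ: "P \<in> carrier_mat n n" "Q \<in> carrier_mat n n" using carr by (simp_all add: P_def Q_def alg)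
  have "(P + Q) * (P + Q) = Z * (rdiag n (\<lambda>k. s k * s k) * mat_adjoint Z)"
    unfolding P_def Q_def eq using carr by (simp add: alg)
  moreover have "(P + Q) * (P + Q) = P * P + P * Q + (Q * P + Q * Q)"
    using add_mult_distrib_mat[OF PQ add_carrier_mat[OF PQ(2), of P]] mult_add_distrib_mat[OF PQ(1) PQ] mult_add_distrib_mat[OF PQ(2) PQ]
    by (simp only:)
  moreover have "mtrace (P * P + P * Q + (Q * P + Q * Q)) = mtrace (P * P) + mtrace (P * Q) + (mtrace (Q * P) + mtrace (Q * Q))"
    using PQ by (simp add: mtrace_add[of _ n] mult_carrier_sq[where n = n])
  moreover have "mtrace (Z * (rdiag n (\<lambda>k. s k * s k) * mat_adjoint Z)) = complex_of_real (\<Sum>k<n. s k * s k)"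
    by (simp only: mtrace_conj[OF Z rdiag_carrier] mtrace_rdiag)
  ultimately have "mtrace (P * P) + mtrace (P * Q) + (mtrace (Q * P) + mtrace (Q * Q)) = complex_of_real (\<Sum>k<n. s k * s k)"
    by (simp only:)
  moreover have "mtrace (Q * P) = mtrace (P * Q)" by (rule mtrace_comm[OF PQ(2,1)])
  moreover have "mtrace (P * Q) = complex_of_real (\<Sum>i<n. \<Sum>j<n. w i j * (p i * r j))"
    unfolding P_def Q_def w_def by (rule mtrace_rdiag_conj[OF carr(1)])
  moreover have "mtrace (P * P) = complex_of_real (\<Sum>i<n. p i * p i)" by (simp add: P_def mtrace_rdiag)
  moreover have "Q * Q = U * (rdiag n (\<lambda>k. r k * r k) * mat_adjoint U)" using carr by (simp add: Q_def alg)
  then have "mtrace (Q * Q) = complex_of_real (\<Sum>i<n. r i * r i)"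
    by (simp only: mtrace_conj[OF U rdiag_carrier] mtrace_rdiag)
  ultimately have "complex_of_real ((\<Sum>i<n. p i * p i) + (\<Sum>i<n. \<Sum>j<n. w i j * (p i * r j))
     + ((\<Sum>i<n. \<Sum>j<n. w i j * (p i * r j)) + (\<Sum>i<n. r i * r i))) = complex_of_real (\<Sum>k<n. s k * s k)"
    by (simp only: of_real_add)
  then have *: "(\<Sum>k<n. s k * s k) = (\<Sum>i<n. p i * p i) + (\<Sum>i<n. \<Sum>j<n. w i j * (p i * r j))
     + ((\<Sum>i<n. \<Sum>j<n. w i j * (p i * r j)) + (\<Sum>i<n. r i * r i))"
    by (simp only: of_real_eq_iff)
  have "(\<Sum>i<n. \<Sum>j<n. w i j * (p i + r j)\<^sup>2)
      = (\<Sum>i<n. \<Sum>j<n. w i j * (p i * p i) + w i j * (p i * r j) + (w i j * (p i * r j) + w i j * (r j * r j)))"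
    by (intro sum.cong refl) (simp add: power2_eq_square algebra_simps)
  then show ?thesis
    unfolding power2_eq_square[of "s _"] *
    by (simp only: sum.distrib w_sum_left[of "\<lambda>i. p i * p i"] w_sum_right[of "\<lambda>i. r i * r i"])
qed

text \<open>The disjoint union carries one signed measure, with mass -1 at each s_k and mass w_ij at
  each p_i + r_j. This is the shape that the kernel criteria expect.\<close>

lemma signed_sum:
  "(\<Sum>a\<in>{..<n} <+> {..<n} \<times> {..<n}. case_sum (\<lambda>_. -1) (case_prod w) a * f (case_sum s (\<lambda>(i, j). p i + r j) a))
   = (\<Sum>i<n. \<Sum>j<n. w i j * f (p i + r j)) - (\<Sum>k<n. f (s k))"
  by (simp add: sum.Plus sum.cartesian_product comp_def case_prod_beta sum_negf)

lemma powr_sum_sign: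
  assumes s: "\<And>k. k < n \<Longrightarrow> 0 \<le> s k" and p: "\<And>i. i < n \<Longrightarrow> 0 \<le> p i" and r: "\<And>i. i < n \<Longrightarrow> 0 \<le> r i"
  shows "1 \<le> q \<Longrightarrow> q \<le> 2 \<Longrightarrow> (\<Sum>k<n. s k powr q) \<le> (\<Sum>i<n. \<Sum>j<n. w i j * (p i + r j) powr q)"
    and "0 < q \<Longrightarrow> q \<le> 1 \<Longrightarrow> (\<Sum>k<n. s k powr q) \<ge> (\<Sum>i<n. \<Sum>j<n. w i j * (p i + r j) powr q)"
    and "2 \<le> q \<Longrightarrow> q \<le> 3 \<Longrightarrow> (\<Sum>k<n. s k powr q) \<ge> (\<Sum>i<n. \<Sum>j<n. w i j * (p i + r j) powr q)"
proof -
  let ?I = "{..<n} <+> {..<n} \<times> {..<n}"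
  let ?c = "case_sum (\<lambda>_. -1) (case_prod w)"
  let ?x = "case_sum s (\<lambda>(i, j). p i + r j)"
  have x: "0 \<le> ?x a" if "a \<in> ?I" for a using that s p r by auto
  have m: "(\<Sum>a\<in>?I. ?c a) = 0" "(\<Sum>a\<in>?I. ?c a * ?x a) = 0" "(\<Sum>a\<in>?I. ?c a * (?x a)\<^sup>2) = 0"
    using signed_sum[of "\<lambda>_. 1"] w_sum_left[of "\<lambda>_. 1"] signed_sum[of "\<lambda>x. x"] signed_sum[of "\<lambda>x. x\<^sup>2"]
      sum_eigenvalues sum_eigenvalues_square w_sum_left[of p] w_sum_right[of r]
    by (simp_all add: distrib_left sum.distrib)
  have res: "0 \<le> (\<Sum>a\<in>?I. ?c a / (1 + t * ?x a))" if t: "0 < t" for t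
  proof -
    \<comment> \<open>Rescaling turns the criterion at t into the resolvent inequality with shift
      1/t.\<close>
    have "1 / (1 + t * y) = (1 / t) * (1 / (y + 1 / t))" if "0 \<le> y" for y
    proof -
      have "1 + t * y \<noteq> 0" "y * t + 1 \<noteq> 0" using t that by (smt (verit) mult_nonneg_nonneg)+
      then show ?thesis using t by (simp add: field_simps)
    qed
    then have "(\<Sum>a\<in>?I. ?c a * (1 / (1 + t * ?x a))) = (\<Sum>a\<in>?I. ?c a * ((1 / t) * (1 / (?x a + 1 / t))))"
      using x by (intro sum.cong) auto
    also have "\<dots> = (1 / t) * (\<Sum>a\<in>?I. ?c a * (1 / (?x a + 1 / t)))"
      unfolding sum_distrib_left by (intro sum.cong) auto
    also have "\<dots> \<ge> 0"
      unfolding signed_sum[of "\<lambda>y. 1 / (y + 1 / t)"] using resolvent_le[of "1 / t"] s p r t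
      by (simp add: add_nonneg_pos)
    finally show ?thesis by simp
  qed
  note * = sum_powr_sign_of_resolvent[of ?I ?x ?c q, OF x m res, unfolded signed_sum[of "\<lambda>x. x powr q"]]
  show "1 \<le> q \<Longrightarrow> q \<le> 2 \<Longrightarrow> (\<Sum>k<n. s k powr q) \<le> (\<Sum>i<n. \<Sum>j<n. w i j * (p i + r j) powr q)"
    and "0 < q \<Longrightarrow> q \<le> 1 \<Longrightarrow> (\<Sum>k<n. s k powr q) \<ge> (\<Sum>i<n. \<Sum>j<n. w i j * (p i + r j) powr q)"
    and "2 \<le> q \<Longrightarrow> q \<le> 3 \<Longrightarrow> (\<Sum>k<n. s k powr q) \<ge> (\<Sum>i<n. \<Sum>j<n. w i j * (p i + r j) powr q)"
    using * by simp_all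
qed

lemma ln_sum_le:
  assumes s: "\<And>k. k < n \<Longrightarrow> 0 < s k" and pr: "\<And>i j. i < n \<Longrightarrow> j < n \<Longrightarrow> 0 < p i + r j"
  shows "(\<Sum>i<n. \<Sum>j<n. w i j * ln (p i + r j)) \<le> (\<Sum>k<n. ln (s k))"
proof -
  let ?I = "{..<n} <+> {..<n} \<times> {..<n}"
  let ?c = "case_sum (\<lambda>_. -1) (case_prod w)"
  let ?x = "case_sum s (\<lambda>(i, j). p i + r j)"
  have "(\<Sum>a\<in>?I. ?c a * ln (?x a)) \<le> 0"
  proof (rule sum_ln_nonpos_of_resolvent)
    show "0 < ?x a" if "a \<in> ?I" for a using that s pr by auto
    show "(\<Sum>a\<in>?I. ?c a) = 0" using signed_sum[of "\<lambda>_. 1"] w_sum_left[of "\<lambda>_. 1"] by simp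
    show "0 \<le> (\<Sum>a\<in>?I. ?c a / (?x a + t))" if "0 \<le> t" for t
      using signed_sum[of "\<lambda>x. 1 / (x + t)"] resolvent_le[of t] s pr that
      by (simp add: add_pos_nonneg)
  qed
  then show ?thesis unfolding signed_sum by simp
qed

end

section \<open>The determinant inequality\<close>

lemma gram_rdiag_index:
  assumes V: "V \<in> carrier_mat n n" and k: "k < n"
  shows "(mat_adjoint V * (rdiag n d * V)) $$ (k, k) = complex_of_real (\<Sum>i<n. d i * (cmod (V $$ (i, k)))\<^sup>2)"
proof -
  have "(mat_adjoint V * (rdiag n d * V)) $$ (k, k) = (\<Sum>i<n. mat_adjoint V $$ (k, i) * (rdiag n d * V) $$ (i, k))"
    by (rule mult_index_sum[OF adjoint_carrier[OF V] mult_carrier_sq[OF rdiag_carrier V] k k])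
  also have "\<dots> = (\<Sum>i<n. complex_of_real (d i * (cmod (V $$ (i, k)))\<^sup>2))"
    using V k by (intro sum.cong refl)
      (simp add: rdiag_mult_left_index[OF V] complex_norm_square mult.commute mult.left_commute del: index_mult_mat of_real_power)
  finally show ?thesis by simp
qed

text \<open>If v_i is the i-th column of \<open>V\<close>, then p_i is the squared length of Y
  v_i.\<close>

lemma gram_eigenvalues_nonneg:
  assumes Y: "Y \<in> carrier_mat n n" and V: "unitary n V"
    and eq: "mat_adjoint Y * Y = V * (rdiag n p * mat_adjoint V)" and i: "i < n"
  shows "0 \<le> p i"
proof -
  note Vc = unitary_carrier[OF V]
  have YV: "Y * V \<in> carrier_mat n n" using Y Vc by (rule mult_carrier_sq)
  have "mat_adjoint V * ((mat_adjoint Y * Y) * V) = rdiag n p"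
    unfolding eq using V Vc by (simp add: assoc_sq[where n = n] mult_carrier_sq[where n = n] unitary_cancel[OF V])
      (simp add: unitary_def)
  moreover have "mat_adjoint V * ((mat_adjoint Y * Y) * V) = mat_adjoint (Y * V) * (rdiag n (\<lambda>_. 1) * (Y * V))"
    using Y Vc YV by (simp add: rdiag_1 adjoint_mult_sq[where n = n] assoc_sq[where n = n] mult_carrier_sq[where n = n])
  ultimately have "complex_of_real (p i) = complex_of_real (\<Sum>l<n. 1 * (cmod ((Y * V) $$ (l, i)))\<^sup>2)"
    using gram_rdiag_index[OF YV i, of "\<lambda>_. 1"] i by (metis rdiag_index)
  then have "p i = (\<Sum>l<n. 1 * (cmod ((Y * V) $$ (l, i)))\<^sup>2)" by (simp only: of_real_eq_iff)
  then show ?thesis by (simp add: sum_nonneg)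
qed

lemma det_one_plus_mult_swap:
  fixes X Y :: "complex mat"
  assumes X: "X \<in> carrier_mat n n" and Y: "Y \<in> carrier_mat n n"
  shows "det (1\<^sub>m n + X * Y) = det (1\<^sub>m n + Y * X)"
proof -
  have "1 \<cdot>\<^sub>m 1\<^sub>m n - (- X) * Y = 1\<^sub>m n + X * Y" "1 \<cdot>\<^sub>m 1\<^sub>m n - Y * (- X) = 1\<^sub>m n + Y * X"
    using X Y by (auto intro!: eq_matI)
  then show ?thesis using det_smult_one_minus_mult_swap[of "- X" n Y 1] X Y by simp
qed

text \<open>This is the quadratic form of the sum at its own unit eigenvector, split over the two
  summands. It is the source of the signs of the s_k.\<close>

lemma (in diag_sum) eigenvalue_eq:
  assumes k: "k < n"
  shows "s k = (\<Sum>i<n. p i * (cmod (Z $$ (i, k)))\<^sup>2) + (\<Sum>j<n. r j * (cmod ((mat_adjoint U * Z) $$ (j, k)))\<^sup>2)"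
proof -
  define V where "V = mat_adjoint U * Z"
  define Q where "Q = U * (rdiag n r * mat_adjoint U)"
  have V: "V \<in> carrier_mat n n" and Q: "Q \<in> carrier_mat n n" using carr by (simp_all add: V_def Q_def alg)
  have "mat_adjoint Z * ((rdiag n p + Q) * Z) = rdiag n s"
    unfolding Q_def eq using Z carr by (simp add: alg) (simp add: unitary_def)
  moreover have "mat_adjoint Z * (Q * Z) = mat_adjoint V * (rdiag n r * V)"
    using carr by (simp add: Q_def V_def alg)
  ultimately have "rdiag n s = mat_adjoint Z * (rdiag n p * Z) + mat_adjoint V * (rdiag n r * V)"
    using sandwich_add[OF carr(4) rdiag_carrier Q carr(2)] by simp
  then have "rdiag n s $$ (k, k) = (mat_adjoint Z * (rdiag n p * Z)) $$ (k, k) + (mat_adjoint V * (rdiag n r * V)) $$ (k, k)"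
    using V k by simp
  then have "complex_of_real (s k) = complex_of_real ((\<Sum>i<n. p i * (cmod (Z $$ (i, k)))\<^sup>2) + (\<Sum>i<n. r i * (cmod (V $$ (i, k)))\<^sup>2))"
    unfolding gram_rdiag_index[OF carr(2) k] gram_rdiag_index[OF V k] using k by simp
  then show ?thesis by (simp only: of_real_eq_iff V_def)
qed

text \<open>For invertible P, det(1 + PQ) = det P det(P^(-1) + Q), and \<open>ln_sum_le\<close>
  applies to P^(-1) and Q. On the scalar side ln(1 + pr) = ln p + ln(1/p + r), where the unit row
  sums of the weights collect the terms ln p into ln det P.\<close>

lemma ln_det_ge_pos:
  assumes U: "unitary n U" and p: "\<And>i. i < n \<Longrightarrow> 0 < p i" and r: "\<And>i. i < n \<Longrightarrow> 0 \<le> r i"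
  shows "exp (\<Sum>i<n. \<Sum>j<n. (cmod (U $$ (i, j)))\<^sup>2 * ln (1 + p i * r j))
    \<le> Re (det (1\<^sub>m n + rdiag n p * (U * (rdiag n r * mat_adjoint U))))"
proof -
  define d where "d = (\<lambda>i. 1 / p i)"
  have d: "0 < d i" if "i < n" for i using p[OF that] by (simp add: d_def)
  define Q where "Q = U * (rdiag n r * mat_adjoint U)"
  note Uc = unitary_carrier[OF U]
  have Q: "Q \<in> carrier_mat n n" using Uc by (simp add: Q_def mult_carrier_sq[where n = n])
  have Qh: "mat_adjoint Q = Q"
    using Uc by (simp add: Q_def adjoint_mult_sq[where n = n] assoc_sq[where n = n] mult_carrier_sq[where n = n])
  have S: "rdiag n d + Q \<in> carrier_mat n n" using Q by simp
  have "mat_adjoint (rdiag n d + Q) = rdiag n d + Q"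
    using adjoint_add[OF rdiag_carrier Q] Qh by simp
  from hermitian_diagonalizable[OF S this] obtain Z s where Z: "unitary n Z"
    and S_eq: "rdiag n d + Q = Z * (rdiag n s * mat_adjoint Z)" by blast
  note Zc = unitary_carrier[OF Z]
  interpret diag_sum n d r s U Z using U Z S_eq by unfold_locales (simp_all add: Q_def)
  have s: "0 < s k" if k: "k < n" for k
  proof -
    obtain i where i: "i < n" "Z $$ (i, k) \<noteq> 0"
      using unitary_col_sum[OF Z k] by (metis (no_types, lifting) lessThan_iff norm_zero sum.neutral zero_neq_one zero_power2)
    have "0 < (\<Sum>i<n. d i * (cmod (Z $$ (i, k)))\<^sup>2)"
      by (rule sum_pos2[of _ i]) (use i d in \<open>auto simp: less_imp_le\<close>)
    moreover have "0 \<le> (\<Sum>j<n. r j * (cmod ((mat_adjoint U * Z) $$ (j, k)))\<^sup>2)" using r by (auto intro!: sum_nonneg)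
    ultimately show ?thesis using eigenvalue_eq[OF k] by simp
  qed
  have "rdiag n p * (rdiag n d + Q) = 1\<^sub>m n + rdiag n p * Q"
  proof -
    have "rdiag n p * rdiag n d = rdiag n (\<lambda>_. 1)"
      unfolding rdiag_mult using p by (intro rdiag_cong) (force simp: d_def)
    then show ?thesis using mult_add_distrib_mat[OF rdiag_carrier rdiag_carrier Q, of p d] by (simp only: rdiag_1)
  qed
  then have "det (1\<^sub>m n + rdiag n p * Q) = det (rdiag n p) * det (rdiag n d + Q)"
    using det_mult[OF rdiag_carrier S, of p] by (simp only:)
  also have "det (rdiag n d + Q) = complex_of_real (\<Prod>k<n. s k)"
    unfolding S_eq det_conj[OF Z rdiag_carrier] det_rdiag ..
  finally have det: "Re (det (1\<^sub>m n + rdiag n p * Q)) = (\<Prod>i<n. p i) * (\<Prod>k<n. s k)"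
    unfolding det_rdiag by (simp flip: of_real_mult of_real_prod)
  have "(\<Sum>i<n. \<Sum>j<n. w i j * ln (1 + p i * r j)) = (\<Sum>i<n. \<Sum>j<n. w i j * ln (p i) + w i j * ln (d i + r j))"
  proof (intro sum.cong refl)
    fix i j assume "i \<in> {..<n}" "j \<in> {..<n}"
    then have "0 < p i" "0 < d i + r j" using p d r by (auto intro: add_pos_nonneg)
    moreover from this have "1 + p i * r j = p i * (d i + r j)" by (simp add: d_def field_simps)
    ultimately have "ln (1 + p i * r j) = ln (p i) + ln (d i + r j)"
      by (simp only: ln_mult_pos)
    then show "w i j * ln (1 + p i * r j) = w i j * ln (p i) + w i j * ln (d i + r j)"
      by (simp only: distrib_left)
  qed
  also have "\<dots> = (\<Sum>i<n. ln (p i)) + (\<Sum>i<n. \<Sum>j<n. w i j * ln (d i + r j))"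
    by (simp add: sum.distrib w_sum_left[of "\<lambda>i. ln (p i)"])
  also have "\<dots> \<le> (\<Sum>i<n. ln (p i)) + (\<Sum>k<n. ln (s k))"
    by (intro add_left_mono ln_sum_le s) (use d r in \<open>auto intro: add_pos_nonneg\<close>)
  finally have "exp (\<Sum>i<n. \<Sum>j<n. w i j * ln (1 + p i * r j)) \<le> exp ((\<Sum>i<n. ln (p i)) + (\<Sum>k<n. ln (s k)))"
    by simp
  also have "\<dots> = (\<Prod>i<n. p i) * (\<Prod>k<n. s k)"
    using p s by (simp add: exp_add exp_sum)
  finally show ?thesis using det by (simp add: w_def Q_def)
qed

lemma tendsto_det:
  fixes M :: "'b \<Rightarrow> complex mat"
  assumes "\<And>x. M x \<in> carrier_mat n n" "L \<in> carrier_mat n n"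
    and "\<And>i j. i < n \<Longrightarrow> j < n \<Longrightarrow> ((\<lambda>x. M x $$ (i, j)) \<longlongrightarrow> L $$ (i, j)) F"
  shows "((\<lambda>x. det (M x)) \<longlongrightarrow> det L) F"
proof -
  have "\<pi> i < n" if "\<pi> permutes {0..<n}" "i < n" for \<pi> i
    using permutes_in_image[OF that(1), of i] that(2) by auto
  then show ?thesis
    unfolding det_def'[OF assms(1)] det_def'[OF assms(2)]
    by (intro tendsto_sum tendsto_mult tendsto_const tendsto_prod assms(3)) auto
qed

text \<open>A singular P is approximated by P + e with e > 0. Both sides are continuous at e = 0,
  the logarithms because 1 + p r \<ge> 1.\<close>

lemma ln_det_ge:
  assumes U: "unitary n U" and p: "\<And>i. i < n \<Longrightarrow> 0 \<le> p i" and r: "\<And>i. i < n \<Longrightarrow> 0 \<le> r i"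
  shows "exp (\<Sum>i<n. \<Sum>j<n. (cmod (U $$ (i, j)))\<^sup>2 * ln (1 + p i * r j))
    \<le> Re (det (1\<^sub>m n + rdiag n p * (U * (rdiag n r * mat_adjoint U))))"
proof -
  define Q where "Q = U * (rdiag n r * mat_adjoint U)"
  have Q: "Q \<in> carrier_mat n n" using unitary_carrier[OF U] by (simp add: Q_def mult_carrier_sq[where n = n])
  define M where "M = (\<lambda>e. 1\<^sub>m n + rdiag n (\<lambda>i. p i + e) * Q)"
  have M: "M e \<in> carrier_mat n n" for e using Q by (simp add: M_def mult_carrier_sq[where n = n])
  have Mij: "M e $$ (i, j) = (if i = j then 1 else 0) + complex_of_real (p i + e) * Q $$ (i, j)" if "i < n" "j < n" for e i j
    using that Q rdiag_mult_left_index[OF Q that] by (simp add: M_def)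
  have "((\<lambda>e. Re (det (M e))) \<longlongrightarrow> Re (det (M 0))) (at_right 0)"
    by (intro tendsto_Re tendsto_det[where n = n] M) (auto simp: Mij intro!: tendsto_eq_intros)
  moreover have "((\<lambda>e. exp (\<Sum>i<n. \<Sum>j<n. (cmod (U $$ (i, j)))\<^sup>2 * ln (1 + (p i + e) * r j)))
     \<longlongrightarrow> exp (\<Sum>i<n. \<Sum>j<n. (cmod (U $$ (i, j)))\<^sup>2 * ln (1 + p i * r j))) (at_right 0)"
  proof (intro tendsto_exp tendsto_sum tendsto_mult tendsto_const)
    fix i j assume "i \<in> {..<n}" "j \<in> {..<n}"
    then have "1 + p i * r j > 0" using p r by (simp add: add_pos_nonneg)
    then show "((\<lambda>e. ln (1 + (p i + e) * r j)) \<longlongrightarrow> ln (1 + p i * r j)) (at_right 0)"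
      by (auto intro!: tendsto_eq_intros)
  qed
  moreover have "\<forall>\<^sub>F e in at_right 0. exp (\<Sum>i<n. \<Sum>j<n. (cmod (U $$ (i, j)))\<^sup>2 * ln (1 + (p i + e) * r j)) \<le> Re (det (M e))"
    using eventually_at_right_less[of "0 :: real"]
  proof eventually_elim
    case (elim e)
    then show ?case unfolding M_def Q_def using p r by (intro ln_det_ge_pos[OF U]) (auto intro: add_nonneg_pos)
  qed
  ultimately have "exp (\<Sum>i<n. \<Sum>j<n. (cmod (U $$ (i, j)))\<^sup>2 * ln (1 + p i * r j)) \<le> Re (det (M 0))"
    by (intro tendsto_le[OF _ _ _]) (auto simp: trivial_limit_at_right_real)
  then show ?thesis by (simp add: M_def Q_def)
qed

section \<open>The trace inequality\<close>

text \<open>The signed measure has mass 1 at each \<mu>_k and -|U_ij|^2 at each p_i r_j.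
  \<open>trace\<close> says that its first moment vanishes, and \<open>det\<close> turns the
  determinant inequality into the sign of its logarithmic sums; the scale t is absorbed into
  r.\<close>

lemma log_majorized_powr_sums:
  fixes p r \<mu> :: "nat \<Rightarrow> real"
  assumes U: "unitary n U" and p: "\<And>i. i < n \<Longrightarrow> 0 \<le> p i" and r: "\<And>i. i < n \<Longrightarrow> 0 \<le> r i"
    and \<mu>: "\<And>k. k < n \<Longrightarrow> 0 \<le> \<mu> k"
    and trace: "(\<Sum>k<n. \<mu> k) = (\<Sum>i<n. \<Sum>j<n. (cmod (U $$ (i, j)))\<^sup>2 * (p i * r j))"
    and det: "\<And>t. 0 < t \<Longrightarrow> det (1\<^sub>m n + rdiag n p * (U * (rdiag n (\<lambda>j. t * r j) * mat_adjoint U)))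
      = complex_of_real (\<Prod>k<n. 1 + t * \<mu> k)"
  shows "0 < s \<Longrightarrow> s \<le> 1 \<Longrightarrow>
      (\<Sum>i<n. \<Sum>j<n. (cmod (U $$ (i, j)))\<^sup>2 * (p i * r j) powr s) \<le> (\<Sum>k<n. \<mu> k powr s)"
    and "1 \<le> s \<Longrightarrow> s < 2 \<Longrightarrow>
      (\<Sum>i<n. \<Sum>j<n. (cmod (U $$ (i, j)))\<^sup>2 * (p i * r j) powr s) \<ge> (\<Sum>k<n. \<mu> k powr s)"
proof -
  let ?w = "\<lambda>i j. (cmod (U $$ (i, j)))\<^sup>2"
  let ?I = "{..<n} <+> {..<n} \<times> {..<n}"
  let ?c = "case_sum (\<lambda>_. 1) (\<lambda>(i, j). - ?w i j)"
  let ?x = "case_sum \<mu> (\<lambda>(i, j). p i * r j)"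
  have signed: "(\<Sum>a\<in>?I. ?c a * f (?x a)) = (\<Sum>k<n. f (\<mu> k)) - (\<Sum>i<n. \<Sum>j<n. ?w i j * f (p i * r j))"
    for f :: "real \<Rightarrow> real"
    by (simp add: sum.Plus sum.cartesian_product comp_def case_prod_beta sum_negf)
  have x: "0 \<le> ?x a" if "a \<in> ?I" for a using that p r \<mu> by auto
  have m1: "(\<Sum>a\<in>?I. ?c a * ?x a) = 0" using signed[of "\<lambda>x. x"] trace by simp
  have log: "0 \<le> (\<Sum>a\<in>?I. ?c a * ln (1 + t * ?x a))" if t: "0 < t" for t
  proof -
    have pos: "0 < 1 + t * \<mu> k" if "k < n" for k using \<mu>[OF that] t by (simp add: add_pos_nonneg)
    have "exp (\<Sum>i<n. \<Sum>j<n. ?w i j * ln (1 + p i * (t * r j)))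
        \<le> Re (det (1\<^sub>m n + rdiag n p * (U * (rdiag n (\<lambda>j. t * r j) * mat_adjoint U))))"
      by (rule ln_det_ge[OF U]) (use p r t in auto)
    also have "\<dots> = (\<Prod>k<n. 1 + t * \<mu> k)" unfolding det[OF t] by (rule Re_complex_of_real)
    also have "\<dots> = exp (\<Sum>k<n. ln (1 + t * \<mu> k))"
      using pos by (simp add: exp_sum)
    finally have "(\<Sum>i<n. \<Sum>j<n. ?w i j * ln (1 + t * (p i * r j))) \<le> (\<Sum>k<n. ln (1 + t * \<mu> k))"
      by (simp add: mult.left_commute)
    then show ?thesis unfolding signed[of "\<lambda>x. ln (1 + t * x)"] by simp
  qed
  note * = sum_powr_sign_of_log[of ?I ?x ?c s, OF x m1 log, unfolded signed[of "\<lambda>x. x powr s"]]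
  show "0 < s \<Longrightarrow> s \<le> 1 \<Longrightarrow>
      (\<Sum>i<n. \<Sum>j<n. ?w i j * (p i * r j) powr s) \<le> (\<Sum>k<n. \<mu> k powr s)"
    and "1 \<le> s \<Longrightarrow> s < 2 \<Longrightarrow>
      (\<Sum>i<n. \<Sum>j<n. ?w i j * (p i * r j) powr s) \<ge> (\<Sum>k<n. \<mu> k powr s)"
    using * by simp_all
qed

lemma rdiag_scale: "rdiag n (\<lambda>i. t * d i) = complex_of_real t \<cdot>\<^sub>m rdiag n d"
  by (rule eq_matI) auto

lemma sandwich_smult:
  fixes X A Y :: "complex mat"
  assumes "X \<in> carrier_mat n n" "A \<in> carrier_mat n n" "Y \<in> carrier_mat n n"
  shows "X * ((k \<cdot>\<^sub>m A) * Y) = k \<cdot>\<^sub>m (X * (A * Y))"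
  unfolding mult_smult_assoc_mat[OF assms(2,3)] by (rule mult_smult_distrib[OF assms(1) mult_carrier_sq[OF assms(2,3)]])

lemma gram_hermitian:
  fixes Y :: "complex mat"
  assumes "Y \<in> carrier_mat n n"
  shows "mat_adjoint (mat_adjoint Y * Y) = mat_adjoint Y * Y"
  using assms by (simp add: adjoint_mult_sq[where n = n])

lemma gram_diagonalizable:
  fixes Y :: "complex mat"
  assumes Y: "Y \<in> carrier_mat n n"
  obtains V p where "unitary n V" "mat_adjoint Y * Y = V * (rdiag n p * mat_adjoint V)"
    "\<And>i. i < n \<Longrightarrow> 0 \<le> p i" "\<And>q. tr_pow (mat_adjoint Y * Y) q = (\<Sum>i<n. p i powr q)"
proof -
  obtain V p where V: "unitary n V" "mat_adjoint Y * Y = V * (rdiag n p * mat_adjoint V)"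
    using hermitian_diagonalizable[OF mult_carrier_sq[OF adjoint_carrier[OF Y] Y] gram_hermitian[OF Y]] by blast
  show thesis
    by (rule that[OF V]) (use gram_eigenvalues_nonneg[OF Y V] tr_pow_conj[OF V(1)] V(2) in auto)
qed

text \<open>A Gram matrix T is its own modulus, so the Schatten expression built on T^* T = T^2 with
  exponent q/2 is just tr T^q.\<close>

lemma tr_pow_gram_square:
  fixes Y :: "complex mat"
  assumes Y: "Y \<in> carrier_mat n n"
  shows "tr_pow ((mat_adjoint Y * Y) * (mat_adjoint Y * Y)) (q / 2) = tr_pow (mat_adjoint Y * Y) q"
proof -
  obtain V p where V: "unitary n V" "mat_adjoint Y * Y = V * (rdiag n p * mat_adjoint V)"
    and p: "\<And>i. i < n \<Longrightarrow> 0 \<le> p i" and tr: "\<And>q. tr_pow (mat_adjoint Y * Y) q = (\<Sum>i<n. p i powr q)"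
    using gram_diagonalizable[OF Y] by blast
  have "(mat_adjoint Y * Y) * (mat_adjoint Y * Y) = V * (rdiag n (\<lambda>i. p i * p i) * mat_adjoint V)"
    unfolding V(2) using unitary_carrier[OF V(1)]
    by (simp add: assoc_sq[where n = n] mult_carrier_sq[where n = n] unitary_cancel[OF V(1)] rdiag_mult_assoc)
  then have "tr_pow ((mat_adjoint Y * Y) * (mat_adjoint Y * Y)) (q / 2) = (\<Sum>i<n. (p i * p i) powr (q / 2))"
    using tr_pow_conj[OF V(1)] by simp
  also have "\<dots> = (\<Sum>i<n. p i powr q)"
    using p by (intro sum.cong refl) (simp add: powr_mult powr_add[symmetric])
  finally show ?thesis by (simp add: tr)
qed

text \<open>The square form of the main estimate: Y1^* Y1, Y2^* Y2 and \<open>G\<close> stand for B,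
  D and C after padding, and Y1 Y1^* + Y2 Y2^* for a matrix with the spectrum of A.\<close>

lemma tr_pow_sum_sign:
  fixes Y1 Y2 :: "complex mat"
  assumes Y1: "Y1 \<in> carrier_mat n n" and Y2: "Y2 \<in> carrier_mat n n" and q: "q > 0"
  defines "G \<equiv> mat_adjoint Y2 * Y1"
  shows "1 \<le> q \<Longrightarrow> q \<le> 2 \<Longrightarrow> tr_pow (Y1 * mat_adjoint Y1 + Y2 * mat_adjoint Y2) q
      \<le> (2 powr q - 2) * tr_pow (mat_adjoint G * G) (q / 2) + tr_pow (mat_adjoint Y1 * Y1) q + tr_pow (mat_adjoint Y2 * Y2) q"
    and "q \<le> 1 \<Longrightarrow> tr_pow (Y1 * mat_adjoint Y1 + Y2 * mat_adjoint Y2) q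
      \<ge> (2 powr q - 2) * tr_pow (mat_adjoint G * G) (q / 2) + tr_pow (mat_adjoint Y1 * Y1) q + tr_pow (mat_adjoint Y2 * Y2) q"
    and "2 \<le> q \<Longrightarrow> q \<le> 3 \<Longrightarrow> tr_pow (Y1 * mat_adjoint Y1 + Y2 * mat_adjoint Y2) q
      \<ge> (2 powr q - 2) * tr_pow (mat_adjoint G * G) (q / 2) + tr_pow (mat_adjoint Y1 * Y1) q + tr_pow (mat_adjoint Y2 * Y2) q"
proof -
  note sq = assoc_sq[where n = n] mult_carrier_sq[where n = n] adjoint_mult_sq[where n = n]
  note adj = adjoint_carrier[OF Y1] adjoint_carrier[OF Y2]
  define P where "P = Y1 * mat_adjoint Y1"
  define Q where "Q = Y2 * mat_adjoint Y2"
  have P: "P \<in> carrier_mat n n" and Q: "Q \<in> carrier_mat n n" and G: "G \<in> carrier_mat n n"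
    using Y1 Y2 by (simp_all add: P_def Q_def G_def sq)
  obtain V p where V: "unitary n V" and P_eq: "P = V * (rdiag n p * mat_adjoint V)"
    and p: "\<And>i. i < n \<Longrightarrow> 0 \<le> p i" and trP: "\<And>q. tr_pow P q = (\<Sum>i<n. p i powr q)"
    using gram_diagonalizable[OF adj(1)] unfolding P_def adjoint_adjoint by blast
  obtain V' r where V': "unitary n V'" and Q_eq: "Q = V' * (rdiag n r * mat_adjoint V')"
    and r: "\<And>i. i < n \<Longrightarrow> 0 \<le> r i" and trQ: "\<And>q. tr_pow Q q = (\<Sum>i<n. r i powr q)"
    using gram_diagonalizable[OF adj(2)] unfolding Q_def adjoint_adjoint by blast
  obtain X \<mu> where X: "unitary n X" and G_eq: "mat_adjoint G * G = X * (rdiag n \<mu> * mat_adjoint X)"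
    and \<mu>: "\<And>i. i < n \<Longrightarrow> 0 \<le> \<mu> i" and trG: "\<And>q. tr_pow (mat_adjoint G * G) q = (\<Sum>i<n. \<mu> i powr q)"
    using gram_diagonalizable[OF G] by blast
  have S: "P + Q \<in> carrier_mat n n" using P Q by simp
  have "mat_adjoint (P + Q) = P + Q"
    using Y1 Y2 by (simp add: adjoint_add[OF P Q]) (simp add: P_def Q_def sq)
  from hermitian_diagonalizable[OF S this] obtain Z0 s where Z0: "unitary n Z0"
    and S_eq: "P + Q = Z0 * (rdiag n s * mat_adjoint Z0)" by blast
  note c = unitary_carrier[OF V] unitary_carrier[OF V'] unitary_carrier[OF Z0] unitary_carrier[OF X]
  \<comment> \<open>Its entries are the inner products of eigenvectors of \<open>P\<close> with
    eigenvectors of \<open>Q\<close>.\<close>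
  define U where "U = mat_adjoint V * V'"
  have U: "unitary n U" unfolding U_def by (rule unitary_mult[OF unitary_adjoint[OF V] V'])
  note Uc = unitary_carrier[OF U]
  have conjQ: "U * (rdiag n f * mat_adjoint U) = mat_adjoint V * ((V' * (rdiag n f * mat_adjoint V')) * V)" for f
    using c by (simp add: U_def sq)
  have conjP: "mat_adjoint V * (P * V) = rdiag n p"
    using c V by (simp add: P_eq sq unitary_cancel[OF V]) (simp add: unitary_def)
  interpret diag_sum n p r s U "mat_adjoint V * Z0"
  proof
    show "unitary n U" by (rule U)
    show "unitary n (mat_adjoint V * Z0)" by (rule unitary_mult[OF unitary_adjoint[OF V] Z0])
    have "rdiag n p + U * (rdiag n r * mat_adjoint U) = mat_adjoint V * (P * V) + mat_adjoint V * (Q * V)"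
      by (simp only: conjP conjQ Q_eq)
    also have "\<dots> = mat_adjoint V * ((P + Q) * V)"
      using sandwich_add[OF adjoint_carrier[OF c(1)] P Q c(1)] by simp
    also have "\<dots> = (mat_adjoint V * Z0) * (rdiag n s * mat_adjoint (mat_adjoint V * Z0))"
      unfolding S_eq using c by (simp add: sq)
    finally show "rdiag n p + U * (rdiag n r * mat_adjoint U) = (mat_adjoint V * Z0) * (rdiag n s * mat_adjoint (mat_adjoint V * Z0))" .
  qed
  have trS: "tr_pow (P + Q) q = (\<Sum>i<n. s i powr q)" for q
    unfolding S_eq by (rule tr_pow_conj[OF Z0])
  have s: "0 \<le> s k" if k: "k < n" for k
    unfolding eigenvalue_eq[OF k] using p r by (intro add_nonneg_nonneg sum_nonneg mult_nonneg_nonneg) auto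
  have GG: "mat_adjoint Y1 * (Q * Y1) = mat_adjoint G * G"
    using Y1 Y2 by (simp add: Q_def G_def sq)
  \<comment> \<open>No square root of P is taken: with P = Y1 Y1^*, the factor Y1 is moved to the
    other end of the product by the determinant swap, and Y1^* Q Y1 = G^* G. The trace below uses
    the same shift.\<close>
  have detG: "det (1\<^sub>m n + rdiag n p * (U * (rdiag n (\<lambda>j. t * r j) * mat_adjoint U)))
      = complex_of_real (\<Prod>k<n. 1 + t * \<mu> k)" for t
  proof -
    let ?Qt = "complex_of_real t \<cdot>\<^sub>m Q"
    have Qt: "?Qt \<in> carrier_mat n n" using Q by simp
    have "V' * (rdiag n (\<lambda>j. t * r j) * mat_adjoint V') = ?Qt"
      unfolding rdiag_scale Q_eq by (rule sandwich_smult[OF c(2) rdiag_carrier adjoint_carrier[OF c(2)]])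
    then have "rdiag n p * (U * (rdiag n (\<lambda>j. t * r j) * mat_adjoint U)) = mat_adjoint V * ((P * ?Qt) * V)"
      using c P Qt by (simp add: conjQ conjP[symmetric] sq unitary_cancel[OF V])
    moreover have "1\<^sub>m n = mat_adjoint V * (1\<^sub>m n * V)" using V c(1) by (simp add: unitary_def)
    ultimately have "1\<^sub>m n + rdiag n p * (U * (rdiag n (\<lambda>j. t * r j) * mat_adjoint U))
        = mat_adjoint V * ((1\<^sub>m n + P * ?Qt) * V)"
      using sandwich_add[OF adjoint_carrier[OF c(1)] one_carrier_mat mult_carrier_sq[OF P Qt] c(1)] by simp
    then have "det (1\<^sub>m n + rdiag n p * (U * (rdiag n (\<lambda>j. t * r j) * mat_adjoint U))) = det (1\<^sub>m n + P * ?Qt)"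
      using det_conj[OF unitary_adjoint[OF V], of "1\<^sub>m n + P * ?Qt"] mult_carrier_sq[OF P Qt] by simp
    also have "P * ?Qt = Y1 * (mat_adjoint Y1 * ?Qt)"
      unfolding P_def by (rule assoc_sq[OF Y1 adj(1) Qt])
    also have "det (1\<^sub>m n + Y1 * (mat_adjoint Y1 * ?Qt)) = det (1\<^sub>m n + (mat_adjoint Y1 * ?Qt) * Y1)"
      by (rule det_one_plus_mult_swap[OF Y1 mult_carrier_sq[OF adj(1) Qt]])
    also have "(mat_adjoint Y1 * ?Qt) * Y1 = complex_of_real t \<cdot>\<^sub>m (mat_adjoint Y1 * (Q * Y1))"
      using assoc_sq[OF adj(1) Qt Y1] sandwich_smult[OF adj(1) Q Y1] by simp
    also have "mat_adjoint Y1 * (Q * Y1) = mat_adjoint G * G" by (rule GG)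
    also have "complex_of_real t \<cdot>\<^sub>m (mat_adjoint G * G) = X * (rdiag n (\<lambda>k. t * \<mu> k) * mat_adjoint X)"
      unfolding rdiag_scale G_eq by (rule sandwich_smult[OF c(4) rdiag_carrier adjoint_carrier[OF c(4)], symmetric])
    also have "1\<^sub>m n + \<dots> = X * ((rdiag n (\<lambda>_. 1) + rdiag n (\<lambda>k. t * \<mu> k)) * mat_adjoint X)"
      using sandwich_add[OF c(4) rdiag_carrier rdiag_carrier adjoint_carrier[OF c(4)], of "\<lambda>_. 1"] X c
      by (simp add: rdiag_1) (simp add: unitary_def)
    also have "det \<dots> = complex_of_real (\<Prod>k<n. 1 + t * \<mu> k)"
      unfolding rdiag_add det_conj[OF X rdiag_carrier] det_rdiag ..
    finally show ?thesis .
  qed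
  have traceG: "(\<Sum>k<n. \<mu> k) = (\<Sum>i<n. \<Sum>j<n. (cmod (U $$ (i, j)))\<^sup>2 * (p i * r j))"
  proof -
    have "complex_of_real (\<Sum>i<n. \<Sum>j<n. (cmod (U $$ (i, j)))\<^sup>2 * (p i * r j))
        = mtrace (rdiag n p * (U * (rdiag n r * mat_adjoint U)))"
      by (rule mtrace_rdiag_conj[OF Uc, symmetric])
    also have "rdiag n p * (U * (rdiag n r * mat_adjoint U)) = mat_adjoint V * ((P * Q) * V)"
      unfolding conjQ Q_eq[symmetric] conjP[symmetric] using c P Q by (simp add: sq unitary_cancel[OF V])
    also have "mtrace \<dots> = mtrace (P * Q)"
      using mtrace_conj[OF unitary_adjoint[OF V] mult_carrier_sq[OF P Q]] by simp
    also have "P * Q = Y1 * (mat_adjoint Y1 * Q)"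
      unfolding P_def by (rule assoc_sq[OF Y1 adj(1) Q])
    also have "mtrace \<dots> = mtrace ((mat_adjoint Y1 * Q) * Y1)"
      by (rule mtrace_comm[OF Y1 mult_carrier_sq[OF adj(1) Q]])
    also have "(mat_adjoint Y1 * Q) * Y1 = mat_adjoint G * G"
      using assoc_sq[OF adj(1) Q Y1] GG by simp
    also have "mtrace \<dots> = complex_of_real (\<Sum>k<n. \<mu> k)"
      unfolding G_eq mtrace_conj[OF X rdiag_carrier] mtrace_rdiag ..
    finally show ?thesis by (simp only: of_real_eq_iff)
  qed
  \<comment> \<open>The exponent q/2 is at most 1 for q \<le> 2 and lies in [1, 3/2] for 2 \<le> q
    \<le> 3, hence within s < 2.\<close>
  note alt = log_majorized_powr_sums[OF U p r \<mu> traceG detG, of "q / 2", folded w_def]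
  note powr = powr_sum_sign[OF s p r, of q]
  have tr12: "tr_pow (mat_adjoint Y1 * Y1) q = (\<Sum>i<n. p i powr q)" "tr_pow (mat_adjoint Y2 * Y2) q = (\<Sum>i<n. r i powr q)"
    using trP[of q] trQ[of q] tr_pow_mult_swap[OF Y1 adj(1)] tr_pow_mult_swap[OF Y2 adj(2)] by (simp_all add: P_def Q_def)
  have split: "(\<Sum>i<n. \<Sum>j<n. w i j * (K * (p i * r j) powr (q / 2) + p i powr q + r j powr q))
     = K * (\<Sum>i<n. \<Sum>j<n. w i j * (p i * r j) powr (q / 2)) + (\<Sum>i<n. p i powr q) + (\<Sum>i<n. r i powr q)" for K
    by (simp add: distrib_left sum.distrib w_sum_left[of "\<lambda>i. p i powr q"] w_sum_right[of "\<lambda>i. r i powr q"]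
        sum_distrib_left mult.left_commute)
  show "tr_pow (Y1 * mat_adjoint Y1 + Y2 * mat_adjoint Y2) q
      \<le> (2 powr q - 2) * tr_pow (mat_adjoint G * G) (q / 2) + tr_pow (mat_adjoint Y1 * Y1) q + tr_pow (mat_adjoint Y2 * Y2) q"
    if "1 \<le> q" "q \<le> 2"
  proof -
    have K: "0 \<le> 2 powr q - (2 :: real)" using powr_mono[OF \<open>1 \<le> q\<close>, of 2] by simp
    have "(\<Sum>i<n. s i powr q) \<le> (\<Sum>i<n. \<Sum>j<n. w i j * (p i + r j) powr q)" using powr(1) that by simp
    also have "\<dots> \<le> (\<Sum>i<n. \<Sum>j<n. w i j * ((2 powr q - 2) * (p i * r j) powr (q / 2) + p i powr q + r j powr q))"
      using that p r by (intro sum_mono mult_left_mono powr_add_sign(1) w_nonneg) auto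
    also have "\<dots> \<le> (2 powr q - 2) * (\<Sum>k<n. \<mu> k powr (q / 2)) + (\<Sum>i<n. p i powr q) + (\<Sum>i<n. r i powr q)"
      unfolding split using alt(1) q that K by (intro add_right_mono mult_left_mono) auto
    finally show ?thesis by (simp add: tr12 trG trS flip: P_def Q_def)
  qed
  show "tr_pow (Y1 * mat_adjoint Y1 + Y2 * mat_adjoint Y2) q
      \<ge> (2 powr q - 2) * tr_pow (mat_adjoint G * G) (q / 2) + tr_pow (mat_adjoint Y1 * Y1) q + tr_pow (mat_adjoint Y2 * Y2) q"
    if "q \<le> 1"
  proof -
    \<comment> \<open>The negative coefficient turns the upper bound on the weighted product sum
      into the lower bound wanted here.\<close>
    have K: "2 powr q - (2 :: real) \<le> 0" using powr_mono[OF \<open>q \<le> 1\<close>, of 2] by simp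
    have "(2 powr q - 2) * (\<Sum>k<n. \<mu> k powr (q / 2)) + (\<Sum>i<n. p i powr q) + (\<Sum>i<n. r i powr q)
      \<le> (\<Sum>i<n. \<Sum>j<n. w i j * ((2 powr q - 2) * (p i * r j) powr (q / 2) + p i powr q + r j powr q))"
      unfolding split using alt(1) q that K by (intro add_right_mono mult_left_mono_neg) auto
    also have "\<dots> \<le> (\<Sum>i<n. \<Sum>j<n. w i j * (p i + r j) powr q)"
      using that q p r by (intro sum_mono mult_left_mono powr_add_sign(2) w_nonneg) auto
    also have "\<dots> \<le> (\<Sum>i<n. s i powr q)" using powr(2) q that by simp
    finally show ?thesis by (simp add: tr12 trG trS flip: P_def Q_def)
  qed
  show "tr_pow (Y1 * mat_adjoint Y1 + Y2 * mat_adjoint Y2) q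
      \<ge> (2 powr q - 2) * tr_pow (mat_adjoint G * G) (q / 2) + tr_pow (mat_adjoint Y1 * Y1) q + tr_pow (mat_adjoint Y2 * Y2) q"
    if "2 \<le> q" "q \<le> 3"
  proof -
    have K: "0 \<le> 2 powr q - (2 :: real)" using powr_mono[of 1 q 2] that by simp
    have "(2 powr q - 2) * (\<Sum>k<n. \<mu> k powr (q / 2)) + (\<Sum>i<n. p i powr q) + (\<Sum>i<n. r i powr q)
      \<le> (\<Sum>i<n. \<Sum>j<n. w i j * ((2 powr q - 2) * (p i * r j) powr (q / 2) + p i powr q + r j powr q))"
      unfolding split using alt(2) q that K by (intro add_right_mono mult_left_mono) auto
    also have "\<dots> \<le> (\<Sum>i<n. \<Sum>j<n. w i j * (p i + r j) powr q)"
      using that q p r by (intro sum_mono mult_left_mono powr_add_sign(3) w_nonneg) auto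
    also have "\<dots> \<le> (\<Sum>i<n. s i powr q)" using powr(3) that by simp
    finally show ?thesis by (simp add: tr12 trG trS flip: P_def Q_def)
  qed
qed

section \<open>Schatten norms and the block matrix\<close>

lemma tr_pow_nonneg: "0 \<le> tr_pow A p"
  unfolding tr_pow_def by (intro sum_nonneg mult_nonneg_nonneg) auto

lemma schatten_powr: "q > 0 \<Longrightarrow> schatten X q powr q = tr_pow (mat_adjoint X * X) (q / 2)"
  using tr_pow_nonneg[of "mat_adjoint X * X" "q / 2"] by (simp add: schatten_def powr_powr)

lemma psd_mat_factor:
  assumes "psd_mat A n"
  obtains X where "X \<in> carrier_mat n n" "mat_adjoint X * X = A"
proof -
  have A: "A \<in> carrier_mat n n" and herm: "mat_adjoint A = A"
    and psd: "\<And>v. v \<in> carrier_vec n \<Longrightarrow> 0 \<le> Re (\<Sum>i<n. cnj (v $ i) * (A *\<^sub>v v) $ i)"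
    using assms by (auto simp: psd_mat_def)
  obtain U a where U: "unitary n U" and A_eq: "A = U * (rdiag n a * mat_adjoint U)"
    using hermitian_diagonalizable[OF A herm] by blast
  note Uc = unitary_carrier[OF U]
  \<comment> \<open>The eigenvalue is the value of the quadratic form at the k-th column of
    \<open>U\<close>.\<close>
  have a: "0 \<le> a k" if k: "k < n" for k
  proof -
    have AU: "A * U \<in> carrier_mat n n" using A Uc by (rule mult_carrier_sq)
    have "mat_adjoint U * (A * U) = rdiag n a"
      using Uc U by (simp add: A_eq assoc_sq[where n = n] mult_carrier_sq[where n = n] unitary_cancel[OF U])
        (simp add: unitary_def)
    then have "complex_of_real (a k) = (mat_adjoint U * (A * U)) $$ (k, k)" using k by simp
    also have "\<dots> = (\<Sum>i<n. mat_adjoint U $$ (k, i) * (A * U) $$ (i, k))"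
      by (rule mult_index_sum[OF adjoint_carrier[OF Uc] AU k k])
    also have "\<dots> = (\<Sum>i<n. cnj (col U k $ i) * (A *\<^sub>v col U k) $ i)"
      using A Uc k by (intro sum.cong) auto
    finally have "a k = Re (\<Sum>i<n. cnj (col U k $ i) * (A *\<^sub>v col U k) $ i)"
      by (metis Re_complex_of_real)
    then show ?thesis using psd[of "col U k"] Uc k by simp
  qed
  define X where "X = rdiag n (\<lambda>i. sqrt (a i)) * mat_adjoint U"
  have X: "X \<in> carrier_mat n n" using Uc by (simp add: X_def mult_carrier_sq[where n = n])
  have "mat_adjoint X * X = U * (rdiag n (\<lambda>i. sqrt (a i) * sqrt (a i)) * mat_adjoint U)"
    using Uc by (simp add: X_def adjoint_mult_sq[where n = n] assoc_sq[where n = n] mult_carrier_sq[where n = n]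
        rdiag_mult_assoc del: real_sqrt_mult_self)
  also have "rdiag n (\<lambda>i. sqrt (a i) * sqrt (a i)) = rdiag n a"
    by (rule rdiag_cong) (simp add: a)
  finally show thesis using X that A_eq by simp
qed

theorem mainTheorem15:
  fixes B C D :: "complex mat" and n m :: nat and q :: real
  assumes "B \<in> carrier_mat n n" and "D \<in> carrier_mat m m" and "C \<in> carrier_mat m n"
    and "psd_mat (four_block_mat B (mat_adjoint C) C D) (n + m)"
    and "q > 0"
  shows "(1 \<le> q \<and> q \<le> 2 \<longrightarrow>
            tr_pow (four_block_mat B (mat_adjoint C) C D) q
              \<le> (2 powr q - 2) * schatten C q powr q + schatten B q powr q + schatten D q powr q)
       \<and> (q \<le> 1 \<longrightarrow>
            tr_pow (four_block_mat B (mat_adjoint C) C D) q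
              \<ge> (2 powr q - 2) * schatten C q powr q + schatten B q powr q + schatten D q powr q)
       \<and> (2 \<le> q \<and> q \<le> 3 \<longrightarrow>
            tr_pow (four_block_mat B (mat_adjoint C) C D) q
              \<ge> (2 powr q - 2) * schatten C q powr q + schatten B q powr q + schatten D q powr q)"
proof -
  note B = assms(1) and D = assms(2) and C = assms(3) and q = assms(5)
  let ?N = "n + m"
  let ?A = "four_block_mat B (mat_adjoint C) C D"
  obtain X where X: "X \<in> carrier_mat ?N ?N" and XX: "mat_adjoint X * X = ?A"
    using psd_mat_factor[OF assms(4)] by blast
  \<comment> \<open>The coordinate projections cut \<open>X\<close> into its two column blocks while
    keeping all matrices square. Since they are Hermitian idempotents with sum 1, Y1 Y1^* + Y2 Y2^*
    = X X^*.\<close>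
  define J1 where "J1 = (four_block_mat (1\<^sub>m n) (0\<^sub>m n m) (0\<^sub>m m n) (0\<^sub>m m m) :: complex mat)"
  define J2 where "J2 = (four_block_mat (0\<^sub>m n n) (0\<^sub>m n m) (0\<^sub>m m n) (1\<^sub>m m) :: complex mat)"
  have J: "J1 \<in> carrier_mat ?N ?N" "J2 \<in> carrier_mat ?N ?N"
    unfolding J1_def J2_def by (rule four_block_carrier_mat; simp)+
  have Jadj: "mat_adjoint J1 = J1" "mat_adjoint J2 = J2"
    unfolding J1_def J2_def by (subst adjoint_four_block[where ?n1.0 = n and ?m1.0 = n and ?n2.0 = m and ?m2.0 = m]; simp)+
  note blk = mult_four_block_mat[where ?nr1.0 = n and ?n1.0 = n and ?n2.0 = m and ?nr2.0 = m and ?nc1.0 = n and ?nc2.0 = m]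
  have idem: "J1 * J1 = J1" "J2 * J2 = J2"
    unfolding J1_def J2_def by (subst blk; simp)+
  have sumJ: "J1 + J2 = 1\<^sub>m ?N"
    unfolding J1_def J2_def by (rule eq_matI) auto
  note sq = assoc_sq[where n = ?N] mult_carrier_sq[where n = ?N] adjoint_mult_sq[where n = ?N]
  define Y1 where "Y1 = X * J1"
  define Y2 where "Y2 = X * J2"
  have Y: "Y1 \<in> carrier_mat ?N ?N" "Y2 \<in> carrier_mat ?N ?N"
    using X J by (simp_all add: Y1_def Y2_def sq)
  have C': "mat_adjoint C \<in> carrier_mat n m" using C by simp
  have hB: "mat_adjoint B = B" and hD: "mat_adjoint D = D"
  proof -
    have "mat_adjoint ?A = ?A" using assms(4) by (simp add: psd_mat_def)
    then have e: "four_block_mat (mat_adjoint B) (mat_adjoint C) C (mat_adjoint D) = ?A"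
      using adjoint_four_block[OF B C' C D] by simp
    show "mat_adjoint B = B"
    proof (rule eq_matI)
      fix i j assume "i < dim_row B" "j < dim_col B"
      then show "mat_adjoint B $$ (i, j) = B $$ (i, j)"
        using arg_cong[OF e, of "\<lambda>M. M $$ (i, j)"] B D by simp
    qed (use B in auto)
    show "mat_adjoint D = D"
    proof (rule eq_matI)
      fix i j assume "i < dim_row D" "j < dim_col D"
      then show "mat_adjoint D $$ (i, j) = D $$ (i, j)"
        using arg_cong[OF e, of "\<lambda>M. M $$ (n + i, n + j)"] B D by simp
    qed (use D in auto)
  qed
  have prod: "mat_adjoint (X * J) * (X * K) = J * (?A * K)"
    if "J \<in> carrier_mat ?N ?N" "mat_adjoint J = J" "K \<in> carrier_mat ?N ?N" for J K
    using that X by (simp add: sq XX[symmetric])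
  have T1: "mat_adjoint Y1 * Y1 = four_block_mat B (0\<^sub>m n m) (0\<^sub>m m n) (0\<^sub>m m m)"
    unfolding Y1_def prod[OF J(1) Jadj(1) J(1)] unfolding J1_def using B C C' D
    by (subst blk; (subst blk)?; simp)
  have T2: "mat_adjoint Y2 * Y2 = four_block_mat (0\<^sub>m n n) (0\<^sub>m n m) (0\<^sub>m m n) D"
    unfolding Y2_def prod[OF J(2) Jadj(2) J(2)] unfolding J2_def using B C C' D
    by (subst blk; (subst blk)?; simp)
  \<comment> \<open>The product J2 A J1 isolates the lower left block, so \<open>G\<close> is C
    padded with zeros.\<close>
  have G: "mat_adjoint Y2 * Y1 = four_block_mat (0\<^sub>m n n) (0\<^sub>m n m) C (0\<^sub>m m m)"
    unfolding Y1_def Y2_def prod[OF J(2) Jadj(2) J(1)] unfolding J1_def J2_def using B C C' D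
    by (subst blk; (subst blk)?; simp)
  have GG: "mat_adjoint (mat_adjoint Y2 * Y1) * (mat_adjoint Y2 * Y1)
      = four_block_mat (mat_adjoint C * C) (0\<^sub>m n m) (0\<^sub>m m n) (0\<^sub>m m m)"
    unfolding G adjoint_four_block[OF zero_carrier_mat zero_carrier_mat C zero_carrier_mat]
    using C C' left_add_zero_mat[OF mult_carrier_mat[OF C' C]] by (subst blk; simp)
  have "Y1 * mat_adjoint Y1 + Y2 * mat_adjoint Y2 = X * ((J1 + J2) * mat_adjoint X)"
    unfolding sandwich_add[OF X J adjoint_carrier[OF X]]
    using X J Jadj idem assoc_sq[OF J(1) J(1) adjoint_carrier[OF X]] assoc_sq[OF J(2) J(2) adjoint_carrier[OF X]]
    by (simp add: Y1_def Y2_def sq)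
  also have "\<dots> = X * mat_adjoint X" unfolding sumJ using X by simp
  \<comment> \<open>The sum of the Gram matrices is X X^*, while A = X^* X; swapping the factors
    preserves the characteristic polynomial.\<close>
  finally have S: "tr_pow (Y1 * mat_adjoint Y1 + Y2 * mat_adjoint Y2) q = tr_pow ?A q"
    using tr_pow_mult_swap[OF X adjoint_carrier[OF X], of q] XX by simp
  \<comment> \<open>Because B is Hermitian, B^* B = B^2, which is the nonzero block of the square of
    Y1^* Y1. The same works for D with Y2.\<close>
  have "tr_pow (mat_adjoint B * B) (q / 2) = tr_pow ((mat_adjoint Y1 * Y1) * (mat_adjoint Y1 * Y1)) (q / 2)"
  proof -
    have "(mat_adjoint Y1 * Y1) * (mat_adjoint Y1 * Y1) = four_block_mat (mat_adjoint B * B) (0\<^sub>m n m) (0\<^sub>m m n) (0\<^sub>m m m)"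
      unfolding T1 hB using B by (subst blk; simp)
    then show ?thesis using tr_pow_four_block_zero(1)[of "mat_adjoint B * B" n m] B hB by simp
  qed
  then have b: "schatten B q powr q = tr_pow (mat_adjoint Y1 * Y1) q"
    by (simp only: schatten_powr[OF q] tr_pow_gram_square[OF Y(1)])
  have "tr_pow (mat_adjoint D * D) (q / 2) = tr_pow ((mat_adjoint Y2 * Y2) * (mat_adjoint Y2 * Y2)) (q / 2)"
  proof -
    have "(mat_adjoint Y2 * Y2) * (mat_adjoint Y2 * Y2) = four_block_mat (0\<^sub>m n n) (0\<^sub>m n m) (0\<^sub>m m n) (mat_adjoint D * D)"
      unfolding T2 hD using D by (subst blk; simp)
    then show ?thesis using tr_pow_four_block_zero(2)[of "mat_adjoint D * D" m n] D hD by simp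
  qed
  then have d: "schatten D q powr q = tr_pow (mat_adjoint Y2 * Y2) q"
    by (simp only: schatten_powr[OF q] tr_pow_gram_square[OF Y(2)])
  have c: "schatten C q powr q = tr_pow (mat_adjoint (mat_adjoint Y2 * Y1) * (mat_adjoint Y2 * Y1)) (q / 2)"
    unfolding schatten_powr[OF q] GG
    by (rule tr_pow_four_block_zero(1)[symmetric]) (use mult_carrier_mat[OF C' C] in simp)
  show ?thesis
    using tr_pow_sum_sign[OF Y q] unfolding S b c d by blast
qed

end
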